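(* For every positive integer $n$, $$\operatorname{rank}_{\mathbb{R}}(C_n)=\operatorname{rank}_{\mathbb{R}}(H_n)=\left\lfloor\frac{n-1}{2}\right\rfloor+k(n).$$
   Context: For a positive integer $n$, $C_n$ is the real $n\times n$ matrix whose entries, for $1\le i,j\le n$, are determined by $C_n(i,j)\equiv ij \pmod n$ and $0\le C_n(i,j)\le n-1$ (the least nonnegative residue of $ij$ modulo $n$). $H_n$ is the $(n-1)\times(n-1)$ matrix obtained from $C_n$ by deleting the last row and the last column (for $n=1$, $H_1$ is the empty $0\times 0$ matrix, of rank $0$). $k(n)$ denotes the number of proper positive divisors of $n$, i.e. the number of positive divisors $d$ of $n$ with $d<n$ (so $k(1)=0$). *)

theory Defs
  imports "Jordan_Normal_Form.DL_Rank"
begin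

text \<open>Matrices of the library are indexed from 0, so position \<open>(i, j)\<close> carries the
  entry with the 1-based index \<open>(i + 1, j + 1)\<close>.\<close>

definition C_mat :: "nat \<Rightarrow> real mat" where
  "C_mat n = mat n n (\<lambda>(i, j). real (((i + 1) * (j + 1)) mod n))"

definition H_mat :: "nat \<Rightarrow> real mat" where
  "H_mat n = mat_delete (C_mat n) (n - 1) (n - 1)"

definition num_proper_divisors :: "nat \<Rightarrow> nat" where
  "num_proper_divisors n = card {d. 0 < d \<and> d dvd n \<and> d < n}"

text \<open>The first argument of \<^const>\<open>vec_space.rank\<close> is the number of rows, i.e. the dimension of
  the ambient space of the column vectors.\<close>

abbreviation real_mat_rank :: "real mat \<Rightarrow> nat" where
  "real_mat_rank A \<equiv> vec_space.rank (dim_row A) A"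

end

theory Submission
  imports "HOL-Analysis.Complex_Transcendental" "HOL-Number_Theory.Residues" Defs
begin

text \<open>Why the formula holds. Read row and column indices modulo \<open>n\<close>, and write \<open>y mod n\<close> as half of the odd
function \<open>(y mod n) - (-y mod n)\<close> plus \<open>n / 2\<close> times the even function that is \<open>0\<close> on the multiples of \<open>n\<close>
and \<open>1\<close> elsewhere. Accordingly the table of all \<open>i j mod n\<close> is the sum of a table that is odd in \<open>j\<close> and
one that is even in \<open>j\<close>. Adding or subtracting the columns \<open>j\<close> and \<open>n - j\<close> isolates the two parts, so
the column space is the direct sum of theirs, and the rank is the sum of two ranks. Row and column \<open>n\<close>
are zero; therefore \<open>C\<^sub>n\<close> and \<open>H\<^sub>n\<close> are covered by one argument that only looks at indices below \<open>n\<close>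
(lemma \<open>rank_multiplication_table\<close>).

The even part depends on \<open>j\<close> only through \<open>gcd j n\<close>, and its columns at the proper divisors of \<open>n\<close> are
independent because they are triangular for divisibility (\<open>divisor_indicators_independent\<close>). This
gives \<open>k(n)\<close>.

The odd part has the columns \<open>1, \<dots>, (n - 1) div 2\<close> up to sign, and all the depth lies in their independence: an
odd function \<open>f\<close> on the residues with \<open>\<Sum>b. f b * (a b mod n) = 0\<close> for all \<open>a\<close> vanishes
(\<open>odd_sawtooth_kernel_trivial\<close>). By the Fourier series of the sawtooth, the discrete Fourier transform \<open>g\<close>
of \<open>f\<close> satisfies \<open>\<Sum>m\<ge>1. g (a m) / m = 0\<close> for all \<open>a\<close>. If \<open>g b \<noteq> 0\<close>, the function
\<open>g (b * _)\<close> is nonzero at \<open>1\<close>; removing the multiples of the primes that divide \<open>n\<close> leaves a nonzero function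
supported on the units, and projecting it to eigenspaces of the action of the units leaves a joint eigenfunction, that is, an odd Dirichlet character \<open>\<psi>\<close> with \<open>L(1, \<psi>) = \<Sum>m. \<psi> m / m = 0\<close>
(\<open>odd_null_space_imp_char\<close>). So the claim is the theorem that \<open>L(1, \<psi>) \<noteq> 0\<close>, which has two cases.

If \<open>\<psi>\<close> is real (\<open>real_char_series_nonzero\<close>), the Lambert series \<open>\<Sum>m. \<psi> m * x^m / (1 - x^m)\<close> would stay bounded
as \<open>x\<close> tends to \<open>1\<close>. Its power series coefficients \<open>\<Sum>d dvd N. \<psi> d\<close> are nonnegative, and at
least \<open>1\<close> when \<open>N\<close> is a square, so it is unbounded.

If \<open>\<psi>\<close> is not real (\<open>complex_char_series_nonzero\<close>), then \<open>\<psi>\<^sup>2\<close> is not principal either, and \<open>L(s, \<psi>\<^sup>2)\<close> stays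
bounded as \<open>s\<close> decreases to \<open>1\<close>. The inequality \<open>3 + 4 cos \<theta> + cos 2\<theta> \<ge> 0\<close> and the Euler products
give \<open>\<bar>\<zeta>(s)\<^sup>3 L(s, \<psi>)\<^sup>4 L(s, \<psi>\<^sup>2)\<bar> \<ge> 1\<close> for \<open>s > 1\<close>. A zero of \<open>L(s, \<psi>)\<close> at \<open>s = 1\<close> would make the left side of
order \<open>s - 1\<close>.\<close>

section \<open>Summation by parts\<close>

text \<open>Dirichlet's test with an explicit bound. Weights of bounded variation are allowed because
monotone weights do not suffice for the estimate of \<open>L(s, \<psi>)\<close> near a zero at \<open>s = 1\<close>, where the weights
are \<open>1/m - 1/m^s\<close>.\<close>

lemma sums_by_parts:
  fixes a :: "nat \<Rightarrow> real" and b :: "nat \<Rightarrow> complex"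
  assumes bnd: "\<And>N. norm (\<Sum>k<N. b k) \<le> B"
    and var: "summable (\<lambda>k. \<bar>a k - a (Suc k)\<bar>)"
    and lim: "a \<longlonglongrightarrow> 0"
  obtains S where "(\<lambda>k. of_real (a k) * b k) sums S"
    and "norm S \<le> B * (\<Sum>k. \<bar>a k - a (Suc k)\<bar>)"
proof -
  define P where "P N = (\<Sum>k<N. b k)" for N
  define t where "t k = of_real (a k - a (Suc k)) * P (Suc k)" for k
  have parts: "(\<Sum>k<N. of_real (a k) * b k) = (\<Sum>k<N. t k) + of_real (a N) * P N" for N
    by (induction N) (auto simp: t_def P_def algebra_simps)
  have tb: "norm (t k) \<le> B * \<bar>a k - a (Suc k)\<bar>" for k
    using mult_right_mono[OF bnd[of "Suc k"], of "\<bar>a k - a (Suc k)\<bar>"]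
    unfolding t_def P_def norm_mult norm_of_real by (simp only: mult.commute)
  have sb: "summable (\<lambda>k. B * \<bar>a k - a (Suc k)\<bar>)"
    using var by (rule summable_mult)
  have st: "summable (\<lambda>k. norm (t k))"
    by (rule summable_comparison_test'[OF sb, of 0]) (use tb in auto)
  have "norm (suminf t) \<le> (\<Sum>k. norm (t k))"
    by (rule summable_norm[OF st])
  also have "\<dots> \<le> (\<Sum>k. B * \<bar>a k - a (Suc k)\<bar>)"
    by (rule suminf_le[OF tb st sb])
  also have "\<dots> = B * (\<Sum>k. \<bar>a k - a (Suc k)\<bar>)"
    by (rule suminf_mult[OF var])
  finally have nS: "norm (suminf t) \<le> B * (\<Sum>k. \<bar>a k - a (Suc k)\<bar>)" .
  have "(\<lambda>N. norm (a N) * B) \<longlonglongrightarrow> 0"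
    using tendsto_mult_right[OF tendsto_norm_zero[OF lim], of B] by simp
  then have "(\<lambda>N. of_real (a N) * P N) \<longlonglongrightarrow> 0"
    by (rule Lim_null_comparison[rotated])
       (auto simp: norm_mult P_def intro!: always_eventually mult_left_mono bnd)
  moreover have "(\<lambda>N. \<Sum>k<N. t k) \<longlonglongrightarrow> suminf t"
    using summable_LIMSEQ[OF summable_norm_cancel[OF st]] .
  ultimately have "(\<lambda>N. \<Sum>k<N. of_real (a k) * b k) \<longlonglongrightarrow> suminf t + 0"
    unfolding parts by (intro tendsto_add)
  then show ?thesis using nS by (intro that[of "suminf t"]) (simp_all add: sums_def)
qed

lemma sums_by_parts_decseq:
  fixes a :: "nat \<Rightarrow> real" and b :: "nat \<Rightarrow> complex"
  assumes bnd: "\<And>N. norm (\<Sum>k<N. b k) \<le> B"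
    and dec: "decseq a" and lim: "a \<longlonglongrightarrow> 0"
  obtains S where "(\<lambda>k. of_real (a k) * b k) sums S" and "norm S \<le> B * a 0"
proof -
  have eq: "\<bar>a k - a (Suc k)\<bar> = a k - a (Suc k)" for k
    using decseqD[OF dec, of k "Suc k"] by simp
  have "(\<lambda>k. a k - a (Suc k)) sums (a 0 - 0)"
    by (rule telescope_sums'[OF lim])
  then have *: "(\<lambda>k. \<bar>a k - a (Suc k)\<bar>) sums a 0" by (simp add: eq)
  show ?thesis
    using sums_by_parts[OF bnd sums_summable[OF *] lim] that sums_unique[OF *] by metis
qed

text \<open>Full periods cancel, so at most \<open>n\<close> terms of size at most \<open>1\<close> remain. The shift by one
matches series that start at \<open>m = 1\<close>.\<close>

lemma periodic_partial_sums_bounded: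
  fixes c :: "nat \<Rightarrow> complex"
  assumes per: "\<And>m. c (m + n) = c m" and zero: "(\<Sum>m<n. c m) = 0"
    and le1: "\<And>m. norm (c m) \<le> 1" and n: "n > 0"
  shows "norm (\<Sum>m<N. c (Suc m)) \<le> real n"
proof -
  have gen: "norm (\<Sum>m<N. d m) \<le> real n"
    if per: "\<And>m. d (m + n) = d m" and zero: "(\<Sum>m<n. d m) = 0"
    and le1: "\<And>m. norm (d m) \<le> 1" for N and d :: "nat \<Rightarrow> complex"
  proof (induction N rule: less_induct)
    case (less N)
    show ?case
    proof (cases "N \<le> n")
      case True
      have "norm (\<Sum>m<N. d m) \<le> (\<Sum>m<N. 1)" by (rule sum_norm_le) (use le1 in auto)
      then show ?thesis using True by simp
    next
      case False
      define M where "M = N - n"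
      have N: "N = M + n" and M: "M < N" using False n by (auto simp: M_def)
      have "(\<Sum>m<M + n. d m) = (\<Sum>m<n. d m) + (\<Sum>m<M. d m)"
        by (induction M) (auto simp: per algebra_simps)
      then show ?thesis using less.IH[OF M] zero N by simp
    qed
  qed
  have "c n = c 0" using per[of 0] by simp
  then have "(\<Sum>m<n. c (Suc m)) = 0"
    using sum.lessThan_Suc_shift[of c n] sum.lessThan_Suc[of c n] zero by simp
  then show "norm (\<Sum>m<N. c (Suc m)) \<le> real n"
    by (intro gen) (use per le1 in \<open>auto simp flip: add_Suc\<close>)
qed


section \<open>The Fourier series of the sawtooth function\<close>

text \<open>Up to the factor \<open>1 - r\<close> these are the averages of \<open>1, r, \<dots>, r^k\<close>.\<close>

lemma decseq_power_mean:
  fixes r :: real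
  assumes "0 \<le> r" "r \<le> 1"
  shows "decseq (\<lambda>k. (1 - r ^ Suc k) / real (Suc k))"
proof (rule decseq_SucI)
  fix k
  define G where "G = (\<Sum>i<Suc k. r ^ i)"
  have "(\<Sum>i<Suc k. r ^ Suc k) \<le> G"
    unfolding G_def by (intro sum_mono power_decreasing) (use assms in auto)
  then have G: "real (Suc k) * r ^ Suc k \<le> G" by simp
  have 1: "1 - r ^ Suc k = (1 - r) * G"
    unfolding G_def by (rule one_diff_power_eq)
  have 2: "1 - r ^ Suc (Suc k) = (1 - r) * (G + r ^ Suc k)"
    unfolding one_diff_power_eq G_def by simp
  have "(1 - r) * (G + r ^ Suc k) * real (Suc k) \<le> (1 - r) * G * real (Suc (Suc k))"
  proof -
    have "(G + r ^ Suc k) * real (Suc k) \<le> G * real (Suc (Suc k))"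
      using G by (simp add: algebra_simps)
    then show ?thesis using assms(2) by (simp only: mult.assoc) (intro mult_left_mono, auto)
  qed
  then show "(1 - r ^ Suc (Suc k)) / real (Suc (Suc k)) \<le> (1 - r ^ Suc k) / real (Suc k)"
    unfolding 1 2 by (simp add: divide_simps del: power_Suc of_nat_Suc)
qed

text \<open>Abel's limit theorem for this series: the difference between the series at \<open>z\<close> and at \<open>r z\<close> has
the weights \<open>(1 - r^(k+1)) / (k+1)\<close>, which decrease from \<open>1 - r\<close> to \<open>0\<close>, and so it is \<open>O(1 - r)\<close> by
Dirichlet's test. Inside the disc the logarithm series is known.\<close>

lemma sums_Ln_unit_circle:
  assumes z: "norm z = 1" "z \<noteq> 1"
  shows "(\<lambda>k. z ^ Suc k / of_nat (Suc k)) sums (- Ln (1 - z))"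
proof -
  define B where "B = 2 / norm (1 - z)"
  have bnd: "norm (\<Sum>k<N. z ^ Suc k) \<le> B" for N
  proof -
    have "(\<Sum>k<N. z ^ Suc k) = z * ((1 - z ^ N) / (1 - z))"
      using z(2) by (simp add: sum_gp_strict flip: sum_distrib_left)
    moreover have "norm (1 - z ^ N) \<le> 2"
      using norm_triangle_ineq4[of 1 "z ^ N"] z(1) by (simp add: norm_power)
    ultimately show ?thesis
      unfolding B_def by (simp add: norm_mult norm_divide z(1) divide_right_mono)
  qed
  have inv0: "(\<lambda>k. 1 / real (Suc k)) \<longlonglongrightarrow> 0"
    using LIMSEQ_inverse_real_of_nat by (simp add: inverse_eq_divide)
  have dec: "decseq (\<lambda>k. 1 / real (Suc k))"
    by (rule decseq_SucI) (simp add: divide_simps)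
  obtain S where S: "(\<lambda>k. of_real (1 / real (Suc k)) * z ^ Suc k) sums S"
    using sums_by_parts_decseq[OF bnd dec inv0] by metis
  have close: "norm (S + Ln (1 - of_real r * z)) \<le> B * (1 - r)" if r: "0 < r" "r < 1" for r :: real
  proof -
    have nr: "norm (- of_real r * z) < 1" using r z(1) by (simp add: norm_mult)
    have "(\<lambda>n. (-1) ^ Suc n / of_nat n * (- of_real r * z) ^ n) sums Ln (1 + (- of_real r * z))"
      using Ln_series[OF nr] by simp
    then have "(\<lambda>n. (-1) ^ Suc (Suc n) / of_nat (Suc n) * (- of_real r * z) ^ Suc n) sums Ln (1 - of_real r * z)"
      by (subst sums_Suc_iff) simp
    moreover have "(-1) ^ Suc (Suc n) / of_nat (Suc n) * (- of_real r * z) ^ Suc n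
        = - (of_real (r ^ Suc n / real (Suc n)) * z ^ Suc n)" for n
    proof -
      have "(- of_real r * z) ^ Suc n = (-1) ^ Suc n * (of_real r ^ Suc n * z ^ Suc n)"
        by (metis mult_minus1 power_mult_distrib minus_mult_left)
      moreover have "(-1) ^ Suc (Suc n) * (-1) ^ Suc n = (-1 :: complex)"
        by (simp flip: power_add power_mult_distrib)
      ultimately have "(-1) ^ Suc (Suc n) * (- of_real r * z) ^ Suc n = - (of_real r ^ Suc n * z ^ Suc n)"
        by (simp only: mult.assoc[symmetric] mult_minus1 mult_minus_left mult_1_left)
      then show ?thesis by (simp add: field_simps del: power_Suc of_nat_Suc)
    qed
    ultimately have L: "(\<lambda>n. - (of_real (r ^ Suc n / real (Suc n)) * z ^ Suc n)) sums Ln (1 - of_real r * z)"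
      by (simp only:)
    have 1: "(\<lambda>n. of_real ((1 - r ^ Suc n) / real (Suc n)) * z ^ Suc n) sums (S + Ln (1 - of_real r * z))"
      using sums_add[OF S L] by (simp add: algebra_simps diff_divide_distrib del: power_Suc of_nat_Suc)
    have "(\<lambda>n. (1 - r ^ Suc n) * (1 / real (Suc n))) \<longlonglongrightarrow> (1 - 0) * 0"
      using r by (intro tendsto_intros inv0 LIMSEQ_Suc[OF LIMSEQ_realpow_zero]) auto
    then have lim0: "(\<lambda>n. (1 - r ^ Suc n) / real (Suc n)) \<longlonglongrightarrow> 0" by simp
    have dec': "decseq (\<lambda>k. (1 - r ^ Suc k) / real (Suc k))"
      using r by (intro decseq_power_mean) auto
    obtain S' where "(\<lambda>n. of_real ((1 - r ^ Suc n) / real (Suc n)) * z ^ Suc n) sums S'"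
      and "norm S' \<le> B * ((1 - r ^ Suc 0) / real (Suc 0))" 
      using sums_by_parts_decseq[OF bnd dec' lim0] by blast
    with sums_unique2[OF 1] show ?thesis by simp
  qed
  have "Re z < 1"
  proof (rule ccontr)
    assume "\<not> Re z < 1"
    with complex_Re_le_cmod[of z] z(1) have "Re z = 1" by simp
    with z(1) have "Im z = 0" by (simp add: cmod_def)
    with \<open>Re z = 1\<close> z(2) show False by (simp add: complex_eq_iff)
  qed
  then have "1 - z \<notin> \<real>\<^sub>\<le>\<^sub>0" by (auto simp: complex_nonpos_Reals_iff)
  then have "((\<lambda>r. S + Ln (1 - of_real r * z)) \<longlongrightarrow> S + Ln (1 - of_real 1 * z)) (at_left 1)"
    by (intro tendsto_intros) auto
  moreover have "((\<lambda>r. S + Ln (1 - of_real r * z)) \<longlongrightarrow> 0) (at_left (1::real))"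
  proof (rule Lim_null_comparison)
    show "\<forall>\<^sub>F r in at_left 1. norm (S + Ln (1 - of_real r * z)) \<le> B * (1 - r)"
      using eventually_at_left_real[OF less_numeral_extra(1)] by eventually_elim (use close in auto)
    have "((\<lambda>r. B * (1 - r)) \<longlongrightarrow> B * (1 - 1)) (at_left (1::real))"
      by (intro tendsto_intros)
    then show "((\<lambda>r. B * (1 - r)) \<longlongrightarrow> 0) (at_left (1::real))" by simp
  qed
  ultimately have "S + Ln (1 - of_real 1 * z) = 0"
    by (intro tendsto_unique[rotated]) auto
  then have "S = - Ln (1 - z)" by (simp add: eq_neg_iff_add_eq_0)
  with S show ?thesis by simp
qed

text \<open>Take imaginary parts in \<open>-Ln (1 - z)\<close> at \<open>z = cis (2 t)\<close>, where \<open>1 - cis (2 t) = 2 sin t * cis (t - pi/2)\<close>.\<close>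

lemma sawtooth_fourier:
  fixes j :: int and n :: nat
  assumes n: "n > 0"
  shows "(\<lambda>k. sin (2 * pi * real (Suc k) * of_int j / real n) / real (Suc k)) sums
     (if int n dvd j then 0 else pi / 2 - pi * of_int (j mod int n) / real n)"
proof (cases "int n dvd j")
  case True
  then obtain q where q: "j = int n * q" by blast
  have "sin (2 * pi * real (Suc k) * of_int j / real n) = 0" for k
  proof -
    have "2 * pi * real (Suc k) * of_int j / real n = of_int (2 * (int (Suc k) * q)) * pi"
      using n by (simp add: q del: of_nat_Suc)
    then show ?thesis by (simp only: sin_npi_int mult.commute[of _ pi])
  qed
  then show ?thesis using True by simp
next
  case False
  define t where "t = pi * of_int (j mod int n) / real n"
  have jm: "0 < j mod int n" "j mod int n < int n"
    using False n pos_mod_sign[of "int n" j] pos_mod_bound[of "int n" j]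
    unfolding dvd_eq_mod_eq_0 by linarith+
  have t: "0 < t" "t < pi"
  proof -
    have "real_of_int (j mod int n) < of_int (int n)"
      using jm(2) by (simp only: of_int_less_iff)
    then show "0 < t" "t < pi"
      using jm(1) n by (simp_all add: t_def field_simps)
  qed
  have st: "sin t > 0" using t by (rule sin_gt_zero)
  define z where "z = cis (2 * t)"
  have zeq: "1 - z = of_real (2 * sin t) * exp (\<i> * of_real (t - pi / 2))"
    unfolding z_def cis_conv_exp[symmetric]
    by (simp add: complex_eq_iff cos_diff sin_diff cos_double_sin sin_double power2_eq_square)
  have "z \<noteq> 1" using zeq st by auto
  have Ln: "Im (Ln (1 - z)) = t - pi / 2"
  proof -
    have "Ln (1 - z) = of_real (ln (2 * sin t)) + Ln (exp (\<i> * of_real (t - pi / 2)))"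
      unfolding zeq using st by (subst Ln_times_of_real) (auto simp only: Ln_of_real exp_not_eq_zero)
    also have "Ln (exp (\<i> * of_real (t - pi / 2))) = \<i> * of_real (t - pi / 2)"
      by (rule Ln_exp) (use t in auto)
    finally show ?thesis by simp
  qed
  have "(\<lambda>k. z ^ Suc k / of_nat (Suc k)) sums (- Ln (1 - z))"
    by (rule sums_Ln_unit_circle) (use \<open>z \<noteq> 1\<close> in \<open>auto simp: z_def\<close>)
  then have "(\<lambda>k. Im (z ^ Suc k / of_nat (Suc k))) sums Im (- Ln (1 - z))"
    by (rule sums_Im)
  moreover have "Im (z ^ Suc k / of_nat (Suc k)) = sin (2 * pi * real (Suc k) * of_int j / real n) / real (Suc k)" for k
  proof -
    have j: "j = int n * (j div int n) + j mod int n" by simp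
    have "real_of_int j = real n * of_int (j div int n) + of_int (j mod int n)"
      by (subst j) (simp only: of_int_add of_int_mult of_int_of_nat_eq)
    then have "2 * pi * real (Suc k) * of_int j / real n
        = real (Suc k) * (2 * t) + (2 * pi) * of_int (int (Suc k) * (j div int n))"
      using n by (simp add: t_def field_simps del: of_nat_Suc)
    then have "sin (2 * pi * real (Suc k) * of_int j / real n) = sin (real (Suc k) * (2 * t))"
      by (simp only: sin_add sin_int_2pin cos_int_2pin mult_zero_right mult_1_right add_0_right)
    moreover have "Im (w / of_nat (Suc k)) = Im w / real (Suc k)" for w
      by (metis Im_divide_of_nat)
    moreover have "Im (z ^ Suc k) = sin (real (Suc k) * (2 * t))"
      by (simp only: z_def Complex.DeMoivre cis.sel)
    ultimately show ?thesis by (simp only:)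
  qed
  ultimately show ?thesis using False Ln by (simp add: t_def)
qed

section \<open>Residues and the discrete Fourier transform\<close>

lemma periodic_mod:
  fixes F :: "int \<Rightarrow> 'a"
  assumes per: "\<And>x. F (x + int n) = F x"
  shows "F (x mod int n) = F x"
proof -
  have nat: "F (y + int q * int n) = F y" for y q
  proof (induction q)
    case (Suc q)
    have "y + int (Suc q) * int n = (y + int q * int n) + int n" by (simp add: algebra_simps)
    then show ?case using per Suc.IH by presburger
  qed simp
  have "F (y + q * int n) = F y" for y q
  proof (cases "q \<ge> 0")
    case True
    then show ?thesis using nat[of y "nat q"] by simp
  next
    case False
    then show ?thesis using nat[of "y + q * int n" "nat (- q)"] by simp
  qed
  from this[of "x mod int n" "x div int n"] show ?thesis by simp
qed

lemma periodic_cong: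
  fixes F :: "int \<Rightarrow> 'a"
  assumes "\<And>x. F (x + int n) = F x" and "[x = y] (mod int n)"
  shows "F x = F y"
  using periodic_mod[of F n x] periodic_mod[of F n y] assms by (simp add: cong_def)

text \<open>Multiplication by a unit permutes the residues.\<close>

lemma sum_residues_mult:
  fixes F :: "int \<Rightarrow> 'a :: comm_monoid_add"
  assumes n: "n > 0" and per: "\<And>x. F (x + int n) = F x" and c: "coprime c (int n)"
  shows "(\<Sum>b<n. F (c * int b)) = (\<Sum>b<n. F (int b))"
proof -
  have inj: "inj_on (\<lambda>b. nat (c * int b mod int n)) {..<n}"
  proof (rule inj_onI)
    fix x y assume xy: "x \<in> {..<n}" "y \<in> {..<n}"
      and "nat (c * int x mod int n) = nat (c * int y mod int n)"
    then have "c * int x mod int n = c * int y mod int n"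
      using n by (simp add: nat_eq_iff)
    then have "[int x = int y] (mod int n)"
      using cong_mult_lcancel[OF c] by (simp add: cong_def)
    then show "x = y" using xy by (simp add: cong_int_iff cong_def)
  qed
  have img: "(\<lambda>b. nat (c * int b mod int n)) ` {..<n} = {..<n}"
    by (rule endo_inj_surj[OF _ _ inj]) (use n in \<open>auto simp: nat_less_iff\<close>)
  have "(\<Sum>b<n. F (int b)) = (\<Sum>b<n. F (int (nat (c * int b mod int n))))"
    using sum.reindex[OF inj, of "\<lambda>b. F (int b)"] by (simp add: img)
  also have "\<dots> = (\<Sum>b<n. F (c * int b))"
    using n periodic_mod[of F n, OF per] by simp
  finally show ?thesis ..
qed

lemma sum_odd_residues:
  fixes F :: "int \<Rightarrow> complex"
  assumes n: "n > 0" and per: "\<And>x. F (x + int n) = F x" and odd: "\<And>x. F (- x) = - F x"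
  shows "(\<Sum>b<n. F (int b)) = 0"
proof -
  have "(\<Sum>b<n. F (int b)) = - (\<Sum>b<n. F (int b))"
    using sum_residues_mult[of n F "-1", OF n per] by (simp add: odd sum_negf)
  then show ?thesis by simp
qed

text \<open>This is the inversion formula: the inverse transform evaluates at \<open>k0\<close> to \<open>N * f k0\<close> by the
orthogonality of the roots of unity.\<close>

lemma dft_injective:
  fixes f :: "nat \<Rightarrow> complex"
  assumes N: "N > 0" and zero: "\<And>j. j < N \<Longrightarrow> (\<Sum>k<N. f k * cis (2 * pi * real j * real k / real N)) = 0"
    and k0: "k0 < N"
  shows "f k0 = 0"
proof -
  define w where "w k = cis (2 * pi * (real k - real k0) / real N)" for k
  have roots: "(\<Sum>j<N. w k ^ j) = (if k = k0 then of_nat N else 0)" if k: "k < N" for k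
  proof (cases "k = k0")
    case False
    have "w k ^ N = cis (2 * pi * of_int (int k - int k0))"
      unfolding w_def Complex.DeMoivre using N by simp
    also have "\<dots> = 1" by (rule cis_multiple_2pi) auto
    finally have 1: "w k ^ N = 1" .
    have "w k \<noteq> 1"
    proof
      assume "w k = 1"
      then have "cos (2 * pi * (real k - real k0) / real N) = 1"
        by (simp add: w_def complex_eq_iff)
      then obtain i :: int where "2 * pi * (real k - real k0) / real N = of_int i * 2 * pi"
        using cos_one_2pi_int by blast
      then have "(2 * pi) * ((real k - real k0) / real N) = (2 * pi) * of_int i"
        by (simp add: mult_ac)
      then have "(real k - real k0) / real N = of_int i"
        by (subst (asm) mult_cancel_left) simp
      then have "real_of_int (int k - int k0) = of_int (i * int N)"
        using N by (simp add: field_simps)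
      then have eq: "int k - int k0 = i * int N" by (simp only: of_int_eq_iff)
      then have "int N dvd int k - int k0" by simp
      moreover have "\<bar>int k - int k0\<bar> < int N" "int k - int k0 \<noteq> 0" using k k0 False by auto
      ultimately show False using zdvd_imp_le[of "int N" "\<bar>int k - int k0\<bar>"] by simp
    qed
    then show ?thesis using 1 False by (simp add: sum_gp_strict)
  qed (simp add: w_def)
  have "0 = (\<Sum>j<N. cis (- (2 * pi * real j * real k0 / real N)) * (\<Sum>k<N. f k * cis (2 * pi * real j * real k / real N)))"
    using zero by simp
  also have "\<dots> = (\<Sum>j<N. \<Sum>k<N. f k * w k ^ j)"
    by (intro sum.cong refl)
       (simp add: sum_distrib_left w_def Complex.DeMoivre cis_mult algebra_simps diff_divide_distrib)
  also have "\<dots> = (\<Sum>k<N. f k * (\<Sum>j<N. w k ^ j))"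
    by (subst sum.swap) (simp add: sum_distrib_left)
  also have "\<dots> = (\<Sum>k<N. if k = k0 then f k * of_nat N else 0)"
    by (intro sum.cong refl) (simp add: roots)
  also have "\<dots> = f k0 * of_nat N" using k0 by simp
  finally show ?thesis using N by simp
qed

definition residue_dft :: "nat \<Rightarrow> (int \<Rightarrow> complex) \<Rightarrow> int \<Rightarrow> complex" where
  "residue_dft n f m = (\<Sum>b<n. f (int b) * cis (2 * pi * of_int (m * int b) / real n))"

lemma residue_dft_periodic:
  assumes n: "n > 0"
  shows "residue_dft n f (m + int n) = residue_dft n f m"
proof -
  have "cis (2 * pi * of_int ((m + int n) * int b) / real n) = cis (2 * pi * of_int (m * int b) / real n)" for b
  proof -
    have "2 * pi * of_int ((m + int n) * int b) / real n
        = 2 * pi * of_int (m * int b) / real n + 2 * pi * real b"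
      using n by (simp add: field_simps)
    then show ?thesis by (simp add: cis_multiple_2pi flip: cis_mult)
  qed
  then show ?thesis by (simp add: residue_dft_def)
qed

lemma residue_dft_odd:
  assumes n: "n > 0" and per: "\<And>x. f (x + int n) = f x" and odd: "\<And>x. f (- x) = - f x"
  shows "residue_dft n f (- m) = - residue_dft n f m"
proof -
  let ?F = "\<lambda>x. f x * cis (2 * pi * of_int (m * x) / real n)"
  have "?F (x + int n) = ?F x" for x
  proof -
    have "2 * pi * of_int (m * (x + int n)) / real n = 2 * pi * of_int (m * x) / real n + 2 * pi * of_int m"
      using n by (simp add: field_simps)
    then show ?thesis by (simp add: per cis_multiple_2pi flip: cis_mult)
  qed
  then have "(\<Sum>b<n. ?F (-1 * int b)) = (\<Sum>b<n. ?F (int b))"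
    by (intro sum_residues_mult[OF n]) auto
  then have "residue_dft n f m = - residue_dft n f (- m)"
    by (simp add: residue_dft_def odd sum_negf)
  then show ?thesis by simp
qed

text \<open>For odd \<open>f\<close> the cosine terms cancel between \<open>b\<close> and \<open>-b\<close>. This matters for convergence:
\<open>\<Sum>m. cis (m t) / m\<close> diverges at \<open>t = 0\<close>, whereas its sine part converges for every \<open>t\<close>.\<close>

lemma residue_dft_sine:
  assumes n: "n > 0" and per: "\<And>x. f (x + int n) = f x" and odd: "\<And>x. f (- x) = - f x"
  shows "residue_dft n f m = \<i> * (\<Sum>b<n. f (int b) * of_real (sin (2 * pi * of_int (m * int b) / real n)))"
proof -
  have "2 * residue_dft n f m = residue_dft n f m - residue_dft n f (- m)"
    by (simp add: residue_dft_odd[of n f, OF n per odd])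
  also have "\<dots> = (\<Sum>b<n. 2 * (\<i> * (f (int b) * of_real (sin (2 * pi * of_int (m * int b) / real n)))))"
    unfolding residue_dft_def sum_subtractf[symmetric]
    by (intro sum.cong refl) (simp add: complex_eq_iff algebra_simps)
  finally show ?thesis by (simp add: sum_distrib_left[symmetric])
qed

text \<open>Summing the sawtooth series against \<open>f\<close> gives a multiple of the kernel condition, plus a
multiple of the sum of \<open>f b\<close> over the \<open>b\<close> with \<open>a b\<close> not divisible by \<open>n\<close>; the latter vanishes because \<open>f\<close>
is odd.\<close>

lemma sawtooth_kernel_imp_dft_sums_zero:
  assumes n: "n > 0" and per: "\<And>x. f (x + int n) = f x" and odd: "\<And>x. f (- x) = - f x"
    and ker: "\<And>a::int. (\<Sum>b<n. f (int b) * of_int (a * int b mod int n)) = 0"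
  shows "(\<lambda>k. residue_dft n f (a * int (Suc k)) / of_nat (Suc k)) sums 0"
proof -
  define s where "s b = (if int n dvd a * int b then 0 else pi / 2 - pi * of_int (a * int b mod int n) / real n)" for b
  have "(\<lambda>k. \<i> * (\<Sum>b<n. f (int b) * of_real (sin (2 * pi * real (Suc k) * of_int (a * int b) / real n) / real (Suc k))))
      sums (\<i> * (\<Sum>b<n. f (int b) * of_real (s b)))"
    unfolding s_def by (intro sums_mult sums_sum sums_of_real sawtooth_fourier[OF n])
  also have "(\<lambda>k. \<i> * (\<Sum>b<n. f (int b) * of_real (sin (2 * pi * real (Suc k) * of_int (a * int b) / real n) / real (Suc k))))
      = (\<lambda>k. residue_dft n f (a * int (Suc k)) / of_nat (Suc k))"
  proof
    fix k
    have arg: "2 * pi * of_int (a * int (Suc k) * int b) / real n = 2 * pi * real (Suc k) * of_int (a * int b) / real n" for b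
      by (simp add: mult_ac)
    then show "\<i> * (\<Sum>b<n. f (int b) * of_real (sin (2 * pi * real (Suc k) * of_int (a * int b) / real n) / real (Suc k)))
      = residue_dft n f (a * int (Suc k)) / of_nat (Suc k)"
      unfolding residue_dft_sine[of n f, OF n per odd]
      by (simp only: arg of_real_divide times_divide_eq_right sum_divide_distrib[symmetric] of_real_of_nat_eq)
  qed
  also have "(\<Sum>b<n. f (int b) * of_real (s b)) = 0"
  proof -
    let ?F = "\<lambda>x. if int n dvd a * x then 0 else f x"
    have F: "(\<Sum>b<n. ?F (int b)) = 0"
      by (rule sum_odd_residues[OF n]) (auto simp: per odd distrib_left dvd_add_left_iff)
    have "f (int b) * of_real (s b)
        = of_real (pi / 2) * ?F (int b) - of_real (pi / real n) * (f (int b) * of_int (a * int b mod int n))" for b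
      by (auto simp: s_def dvd_eq_mod_eq_0 algebra_simps)
    then have "(\<Sum>b<n. f (int b) * of_real (s b)) = of_real (pi / 2) * (\<Sum>b<n. ?F (int b))
        - of_real (pi / real n) * (\<Sum>b<n. f (int b) * of_int (a * int b mod int n))"
      by (simp only: sum_subtractf sum_distrib_left)
    then show ?thesis by (simp only: F ker) simp
  qed
  finally show ?thesis by simp
qed


section \<open>From the kernel of the sawtooth to a Dirichlet character\<close>

text \<open>The elementary sieve step for conditionally convergent series. It serves for removing the primes
that divide the modulus and for splitting off Euler factors.\<close>

lemma sums_remove_multiples:
  fixes u :: "nat \<Rightarrow> complex"
  assumes p: "p > 0" and S: "(\<lambda>k. u (Suc k)) sums S" and T: "(\<lambda>k. u (p * Suc k)) sums T"
  shows "(\<lambda>k. if p dvd Suc k then 0 else u (Suc k)) sums (S - T)"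
proof -
  define g where "g k = p * Suc k - 1" for k
  have Sg: "Suc (g k) = p * Suc k" for k using p by (simp add: g_def)
  have mono: "strict_mono g"
  proof (rule strict_monoI)
    fix x y :: nat assume "x < y"
    then have "Suc (g x) < Suc (g y)" unfolding Sg using p by simp
    then show "g x < g y" by simp
  qed
  have "(\<lambda>k. (\<lambda>k. if p dvd Suc k then u (Suc k) else 0) (g k)) sums T"
    unfolding Sg using T by simp
  then have "(\<lambda>k. if p dvd Suc k then u (Suc k) else 0) sums T"
  proof (subst (asm) sums_mono_reindex[OF mono])
    fix k assume "k \<notin> range g"
    then have "\<not> p dvd Suc k"
      by (metis Sg dvd_def mult_is_0 nat.exhaust nat.inject nat.distinct(1) range_eqI)
    then show "(if p dvd Suc k then u (Suc k) else 0) = 0" by simp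
  qed
  from sums_diff[OF S this] show ?thesis
    by (rule back_subst[of "\<lambda>f. f sums (S - T)"]) auto
qed

text \<open>The odd functions on the units modulo \<open>n\<close>, extended by zero, that are annihilated by all the
functionals \<open>h \<mapsto> \<Sum>m\<ge>1. h (a m) / m\<close> with \<open>a\<close> a unit. The units act on this space by
\<open>h \<mapsto> h (c * _)\<close>, and it is zero exactly when \<open>L(1, \<psi>) \<noteq> 0\<close> for all odd characters \<open>\<psi>\<close> modulo \<open>n\<close>.\<close>

definition odd_null_space :: "nat \<Rightarrow> (int \<Rightarrow> complex) set" where
  "odd_null_space n = {h. (\<forall>x. h (x + int n) = h x) \<and> (\<forall>x. h (- x) = - h x) \<and>
     (\<forall>x. \<not> coprime x (int n) \<longrightarrow> h x = 0) \<and>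
     (\<forall>a. coprime a (int n) \<longrightarrow> (\<lambda>k. h (a * int (Suc k)) / of_nat (Suc k)) sums 0)}"

lemma prime_divisor_in_set_mult_iff:
  assumes q: "prime (q::nat)" "q \<notin> P" and P: "\<And>p. p \<in> P \<Longrightarrow> prime p"
  shows "(\<exists>p\<in>P. p dvd q * m) \<longleftrightarrow> (\<exists>p\<in>P. p dvd m)"
proof -
  have "p dvd q * m \<longleftrightarrow> p dvd m" if "p \<in> P" for p
  proof -
    have "prime p" "p \<noteq> q" using that P q(2) by auto
    then have "\<not> p dvd q" using q(1) primes_dvd_imp_eq by blast
    then show ?thesis using \<open>prime p\<close> by (simp add: prime_dvd_mult_iff)
  qed
  then show ?thesis by blast
qed

text \<open>The hypothesis is made for all \<open>a\<close> at once, since removing the multiples of \<open>q\<close> at \<open>a\<close> uses the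
series at \<open>a q\<close>.\<close>

lemma sums_remove_prime_multiples:
  fixes g :: "int \<Rightarrow> complex"
  assumes zero: "\<And>a. (\<lambda>k. g (a * int (Suc k)) / of_nat (Suc k)) sums 0"
    and P: "finite P" "\<And>p. p \<in> P \<Longrightarrow> prime (p::nat)"
  shows "(\<lambda>k. (if \<exists>p\<in>P. p dvd Suc k then 0 else g (a * int (Suc k))) / of_nat (Suc k)) sums 0"
  using P
proof (induction P arbitrary: a rule: finite_induct)
  case empty
  then show ?case using zero by simp
next
  case (insert q P)
  define u where "u a m = (if \<exists>p\<in>P. p dvd m then 0 else g (a * int m)) / of_nat m" for a m
  have IH: "(\<lambda>k. u a (Suc k)) sums 0" for a
    unfolding u_def by (rule insert.IH) (use insert.prems in auto)
  have q: "prime q" using insert.prems by auto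
  then have q0: "q > 0" by (rule prime_gt_0_nat)
  have dvd_iff: "(\<exists>p\<in>P. p dvd q * m) \<longleftrightarrow> (\<exists>p\<in>P. p dvd m)" for m
    by (rule prime_divisor_in_set_mult_iff[OF q]) (use insert in auto)
  have uq: "u a (q * m) = u (a * int q) m / of_nat q" for m
    unfolding u_def dvd_iff by (simp add: mult_ac)
  then have "(\<lambda>k. u a (q * Suc k)) sums 0"
    using sums_divide[OF IH[of "a * int q"], of "of_nat q"] by (simp only: uq div_0)
  from sums_remove_multiples[OF q0 IH this]
  have "(\<lambda>k. if q dvd Suc k then 0 else u a (Suc k)) sums 0" by simp
  moreover have "(if q dvd Suc k then 0 else u a (Suc k))
      = (if \<exists>p\<in>insert q P. p dvd Suc k then 0 else g (a * int (Suc k))) / of_nat (Suc k)" for k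
    by (simp add: u_def del: of_nat_Suc)
  ultimately show ?case by simp
qed

text \<open>Being prime to \<open>n\<close> means being divisible by no prime factor of \<open>n\<close>, and those multiples can be
removed. The translation by \<open>b\<close> allows the point \<open>1\<close>, at which the coprime part is surely retained, to carry
any prescribed value of \<open>g\<close>.\<close>

lemma coprime_part_in_odd_null_space:
  assumes n: "n > 0" and per: "\<And>x. g (x + int n) = g x" and odd: "\<And>x. g (- x) = - g x"
    and zero: "\<And>a. (\<lambda>k. g (a * int (Suc k)) / of_nat (Suc k)) sums 0"
  shows "(\<lambda>x. if coprime x (int n) then g (b * x) else 0) \<in> odd_null_space n"
proof -
  have per': "g (b * (x + int n)) = g (b * x)" for x
    by (rule periodic_cong[of g n, OF per]) (simp add: cong_def algebra_simps)
  have cop: "coprime m n \<longleftrightarrow> \<not> (\<exists>p\<in>prime_factors n. p dvd m)" for m :: nat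
  proof
    assume "coprime m n"
    then show "\<not> (\<exists>p\<in>prime_factors n. p dvd m)"
      by (meson coprime_common_divisor in_prime_factors_iff not_prime_unit)
  next
    assume *: "\<not> (\<exists>p\<in>prime_factors n. p dvd m)"
    show "coprime m n"
    proof (rule ccontr)
      assume "\<not> coprime m n"
      then have "gcd m n \<noteq> 1" using coprime_iff_gcd_eq_1 by blast
      then obtain p where "prime p" "p dvd gcd m n" using prime_factor_nat by blast
      then show False using * n by (auto simp: in_prime_factors_iff)
    qed
  qed
  have "(\<lambda>k. (if coprime (a * int (Suc k)) (int n) then g (b * (a * int (Suc k))) else 0) / of_nat (Suc k)) sums 0"
    if a: "coprime a (int n)" for a
  proof -
    have "coprime (a * int (Suc k)) (int n) \<longleftrightarrow> \<not> (\<exists>p\<in>prime_factors n. p dvd Suc k)" for k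
      using a by (simp only: coprime_mult_left_iff coprime_int_iff cop simp_thms)
    then have "(if coprime (a * int (Suc k)) (int n) then g (b * (a * int (Suc k))) else 0)
        = (if \<exists>p\<in>prime_factors n. p dvd Suc k then 0 else g ((b * a) * int (Suc k)))" for k
      by (cases "\<exists>p\<in>prime_factors n. p dvd Suc k")
         (simp_all only: mult.assoc if_True if_False not_True_eq_False not_False_eq_True)
    moreover have "(\<lambda>k. (if \<exists>p\<in>prime_factors n. p dvd Suc k then 0 else g ((b * a) * int (Suc k))) / of_nat (Suc k)) sums 0"
      by (rule sums_remove_prime_multiples[OF zero]) auto
    ultimately show ?thesis by (simp only:)
  qed
  moreover have "coprime (x + int n) (int n) \<longleftrightarrow> coprime x (int n)" for x
    using coprime_iff_gcd_eq_1 gcd_add1 by metis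
  ultimately show ?thesis
    unfolding odd_null_space_def using per' odd by (simp del: of_nat_Suc)
qed

lemma odd_null_space_closed:
  assumes h: "h \<in> odd_null_space n" and u: "\<And>k. coprime (u k) (int n)"
  shows "(\<lambda>x. \<Sum>k<N. c k * h (u k * x)) \<in> odd_null_space n"
proof -
  have per: "h (x + int n) = h x" and odd: "h (- x) = - h x" for x
    using h by (auto simp: odd_null_space_def)
  have "h (u k * (x + int n)) = h (u k * x)" for k x
    by (rule periodic_cong[of h n, OF per]) (simp add: cong_def algebra_simps)
  moreover have "(\<lambda>i. (\<Sum>k<N. c k * h (u k * (a * int (Suc i)))) / of_nat (Suc i)) sums 0"
    if a: "coprime a (int n)" for a
  proof -
    have "(\<lambda>i. h ((u k * a) * int (Suc i)) / of_nat (Suc i)) sums 0" for k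
      using h a u[of k] by (simp add: odd_null_space_def)
    then have "(\<lambda>i. \<Sum>k<N. c k * (h ((u k * a) * int (Suc i)) / of_nat (Suc i))) sums (\<Sum>k<N. c k * 0)"
      by (intro sums_sum sums_mult)
    then show ?thesis by (simp add: sum_divide_distrib mult.assoc del: of_nat_Suc)
  qed
  ultimately show ?thesis
    using h u unfolding odd_null_space_def by (simp add: odd sum_negf)
qed

text \<open>The units commute and have finite order, hence have a joint eigenfunction. To add one more unit \<open>c\<close>
with \<open>c^N = 1\<close>, project \<open>h\<close> to an eigenspace by \<open>h' = \<Sum>k<N. w^k h (c^k * _)\<close>, where \<open>w\<close> is an \<open>N\<close>-th root
of unity. These projections add up to a multiple of \<open>h\<close>, so one of them is nonzero; in the proof this is
\<open>dft_injective\<close> applied along the orbit of a point.\<close>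

lemma odd_null_space_eigenfunction:
  assumes n: "n > 0" and h0: "h0 \<in> odd_null_space n" "h0 x0 \<noteq> 0"
    and A: "finite A" "\<And>c. c \<in> A \<Longrightarrow> coprime c n"
  shows "\<exists>h x. h \<in> odd_null_space n \<and> h x \<noteq> 0 \<and> (\<forall>c\<in>A. \<exists>w. \<forall>y. h (int c * y) = w * h y)"
  using A
proof (induction A rule: finite_induct)
  case empty
  then show ?case using h0 by blast
next
  case (insert c A)
  then obtain h x where h: "h \<in> odd_null_space n" and hx: "h x \<noteq> 0"
    and eig: "\<forall>c\<in>A. \<exists>w. \<forall>y. h (int c * y) = w * h y" by auto
  have c: "coprime c n" using insert.prems by simp
  have per: "h (x + int n) = h x" for x using h by (auto simp: odd_null_space_def)
  define N where "N = totient n"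
  have N: "N > 0" using n by (simp add: N_def)
  have "[c ^ N = 1] (mod n)" unfolding N_def by (rule euler_theorem[OF c])
  then have cN: "[int c ^ N = 1] (mod int n)"
    by (metis cong_int_iff of_nat_1 of_nat_power)
  have "\<exists>j<N. (\<Sum>k<N. h (int c ^ k * x) * cis (2 * pi * real j * real k / real N)) \<noteq> 0"
  proof (rule ccontr)
    assume "\<not> ?thesis"
    then have "h (int c ^ 0 * x) = 0"
      using N by (intro dft_injective[of N "\<lambda>k. h (int c ^ k * x)" 0]) auto
    then show False using hx by simp
  qed
  then obtain j where j: "(\<Sum>k<N. h (int c ^ k * x) * cis (2 * pi * real j * real k / real N)) \<noteq> 0"
    by blast
  define w where "w = cis (2 * pi * real j / real N)"
  have wk: "cis (2 * pi * real j * real k / real N) = w ^ k" for k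
    by (simp add: w_def Complex.DeMoivre mult_ac)
  have wN: "w ^ N = 1"
    using N cis_multiple_2pi[of "real j"] by (simp add: w_def Complex.DeMoivre)
  define h' where "h' y = (\<Sum>k<N. w ^ k * h (int c ^ k * y))" for y
  have "h' \<in> odd_null_space n"
    unfolding h'_def by (rule odd_null_space_closed[OF h]) (use c in simp)
  moreover have "h' x \<noteq> 0" using j unfolding h'_def wk by (simp only: mult.commute[of "w ^ _"] not_False_eq_True)
  moreover have "\<exists>v. \<forall>y. h' (int d * y) = v * h' y" if d: "d \<in> insert c A" for d
  proof (cases "d = c")
    case True
    have "w * h' (int c * y) = h' y" for y
    proof -
      define t where "t k = w ^ k * h (int c ^ k * y)" for k
      have "[int c ^ N * y = 1 * y] (mod int n)" by (intro cong_mult cN cong_refl)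
      then have "t N = t 0"
        using periodic_cong[of h n, OF per] wN by (simp add: t_def)
      then have "(\<Sum>k<N. t (Suc k)) = (\<Sum>k<N. t k)"
        using sum.lessThan_Suc_shift[of t N] sum.lessThan_Suc[of t N] by simp
      then show ?thesis by (simp add: t_def h'_def sum_distrib_left mult_ac)
    qed
    moreover have "w \<noteq> 0" using wN N by (auto simp: power_0_left)
    ultimately have "h' (int c * y) = inverse w * h' y" for y
      by (metis mult.assoc left_inverse mult_1)
    then show ?thesis unfolding True by blast
  next
    case False
    then obtain v where v: "\<forall>y. h (int d * y) = v * h y" using d eig by blast
    have "h' (int d * y) = v * h' y" for y
    proof -
      have "h (int c ^ k * (int d * y)) = v * h (int c ^ k * y)" for k
        using v[rule_format, of "int c ^ k * y"] by (simp add: mult_ac)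
      then show ?thesis by (simp add: h'_def sum_distrib_left mult_ac)
    qed
    then show ?thesis by blast
  qed
  ultimately show ?case by blast
qed

definition dirichlet_char :: "nat \<Rightarrow> (int \<Rightarrow> complex) \<Rightarrow> bool" where
  "dirichlet_char n \<psi> \<longleftrightarrow> (\<forall>x. \<psi> (x + int n) = \<psi> x) \<and> (\<forall>x y. \<psi> (x * y) = \<psi> x * \<psi> y) \<and>
     \<psi> 1 = 1 \<and> (\<forall>x. \<psi> x = 0 \<longleftrightarrow> \<not> coprime x (int n))"

text \<open>A joint eigenfunction is determined by its value at \<open>1\<close>, and normalised to \<open>1\<close> there it equals
its own eigenvalues, which are multiplicative.\<close>

lemma odd_null_space_imp_char:
  assumes n: "n > 0" and h0: "h0 \<in> odd_null_space n" "h0 x0 \<noteq> 0"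
  obtains \<psi> where "dirichlet_char n \<psi>" "\<psi> (- 1) = - 1"
    "(\<lambda>k. \<psi> (int (Suc k)) / of_nat (Suc k)) sums 0"
proof -
  have "\<exists>h x. h \<in> odd_null_space n \<and> h x \<noteq> 0 \<and>
      (\<forall>c\<in>{c. c < n \<and> coprime c n}. \<exists>w. \<forall>y. h (int c * y) = w * h y)"
    by (rule odd_null_space_eigenfunction[OF n h0]) auto
  then obtain h x where h: "h \<in> odd_null_space n" and hx: "h x \<noteq> 0"
    and eig: "\<And>c. c < n \<Longrightarrow> coprime c n \<Longrightarrow> \<exists>w. \<forall>y. h (int c * y) = w * h y" by auto
  have per: "h (x + int n) = h x" and odd: "h (- x) = - h x"
    and supp: "\<not> coprime x (int n) \<Longrightarrow> h x = 0" for x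
    using h by (auto simp: odd_null_space_def)
  have "\<forall>a. coprime a (int n) \<longrightarrow> (\<lambda>k. h (a * int (Suc k)) / of_nat (Suc k)) sums 0"
    using h unfolding odd_null_space_def by (elim CollectE conjE)
  then have sums: "(\<lambda>k. h (1 * int (Suc k)) / of_nat (Suc k)) sums 0"
    by (rule allE[of _ 1]) simp
  have eig': "\<exists>w. \<forall>y. h (z * y) = w * h y" if z: "coprime z (int n)" for z
  proof -
    define c where "c = nat (z mod int n)"
    have c: "int c = z mod int n" using n by (simp add: c_def)
    have "coprime (int c) (int n)" using z n by (simp add: c coprime_mod_left_iff)
    moreover have "c < n" using n by (simp add: c_def nat_less_iff)
    ultimately obtain w where w: "\<forall>y. h (int c * y) = w * h y" using eig[of c] by auto
    have "h (z * y) = h (int c * y)" for y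
      by (rule periodic_cong[of h n, OF per]) (simp add: c cong_def mod_simps)
    then show ?thesis using w by auto
  qed
  have "coprime x (int n)" using supp hx by blast
  then obtain w where "\<forall>y. h (x * y) = w * h y" using eig' by blast
  from this[rule_format, of 1] have h1: "h 1 \<noteq> 0" using hx by auto
  have mult: "h (z * y) * h 1 = h z * h y" for z y
  proof (cases "coprime z (int n)")
    case True
    then obtain w where w: "\<forall>y. h (z * y) = w * h y" using eig' by blast
    from w[rule_format, of 1] w[rule_format, of y] show ?thesis by simp
  next
    case False
    then show ?thesis using supp[of z] supp[of "z * y"] by auto
  qed
  define \<psi> where "\<psi> y = h y / h 1" for y
  have nz: "h y \<noteq> 0" if "coprime y (int n)" for y
  proof -
    from that obtain i where "[y * i = 1] (mod int n)" by (metis cong_solve_coprime_int)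
    then have "h (y * i) = h 1" by (rule periodic_cong[of h n, OF per])
    then show ?thesis using mult[of y i] h1 by auto
  qed
  have "dirichlet_char n \<psi>"
    unfolding dirichlet_char_def \<psi>_def using per h1 mult nz supp
    by (auto simp: field_simps)
  moreover have "\<psi> (- 1) = - 1" using h1 odd[of 1] by (simp add: \<psi>_def)
  moreover have "(\<lambda>k. \<psi> (int (Suc k)) / of_nat (Suc k)) sums 0"
    using sums_divide[OF sums, of "h 1"] by (simp add: \<psi>_def mult_ac)
  ultimately show ?thesis using that by blast
qed

section \<open>Real characters\<close>

text \<open>The terms \<open>i\<close> and \<open>m - i\<close> have the geometric mean \<open>y^m\<close>.\<close>

lemma sum_even_powers_ge:
  fixes y :: real
  shows "real (Suc m) * y ^ m \<le> (\<Sum>i<Suc m. (y\<^sup>2) ^ i)"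
proof -
  have "2 * (real (Suc m) * y ^ m) = (\<Sum>i<Suc m. 2 * y ^ m)" by simp
  also have "\<dots> \<le> (\<Sum>i<Suc m. (y\<^sup>2) ^ i + (y\<^sup>2) ^ (m - i))"
  proof (rule sum_mono)
    fix i assume "i \<in> {..<Suc m}"
    then have "y ^ m = y ^ i * y ^ (m - i)" by (simp flip: power_add)
    moreover have "2 * (y ^ i * y ^ (m - i)) \<le> (y ^ i)\<^sup>2 + (y ^ (m - i))\<^sup>2"
      using sum_squares_bound[of "y ^ i" "y ^ (m - i)"] by simp
    ultimately show "2 * y ^ m \<le> (y\<^sup>2) ^ i + (y\<^sup>2) ^ (m - i)"
      by (simp add: mult.commute flip: power_mult)
  qed
  also have "\<dots> = 2 * (\<Sum>i<Suc m. (y\<^sup>2) ^ i)"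
    using sum.nat_diff_reindex[of "\<lambda>i. (y\<^sup>2) ^ i" "Suc m"] by (simp only: sum.distrib diff_Suc_Suc)
  finally show ?thesis by simp
qed

text \<open>If \<open>\<Sum>m. c m / m = 0\<close>, then the Lambert series \<open>\<Sum>m. c m * x^m / (1 - x^m)\<close> equals
\<open>-\<Sum>m. c m * b m\<close> with these weights \<open>b\<close>, where \<open>m = k + 1\<close>. Unlike \<open>x^m / (1 - x^m)\<close>, they are bounded
uniformly in \<open>x\<close>.\<close>

definition lambert_weight :: "real \<Rightarrow> nat \<Rightarrow> real" where
  "lambert_weight x k = 1 / (real (Suc k) * (1 - x)) - x ^ Suc k / (1 - x ^ Suc k)"

text \<open>With \<open>G m = 1 + x + \<dots> + x^(m-1)\<close>, the difference of consecutive weights times \<open>1 - x\<close> is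
\<open>1 / (m (m + 1)) - x^m / (G m * G (m + 1))\<close>, which is nonnegative by the inequality of arithmetic and
geometric means for \<open>G m\<close> and \<open>G (m + 1)\<close>.\<close>

lemma decseq_lambert_weight:
  assumes x: "0 < x" "x < 1"
  shows "decseq (lambert_weight x)"
proof (rule decseq_SucI)
  fix k
  define m where "m = Suc k"
  define y where "y = sqrt x"
  have y: "y\<^sup>2 = x" "0 \<le> y" "y \<le> 1" using x by (auto simp: y_def)
  define G where "G = (\<Sum>i<m. x ^ i)"
  define H where "H = (\<Sum>i<Suc m. x ^ i)"
  have GH: "H = 1 + x * G"
    unfolding H_def G_def by (subst sum.lessThan_Suc_shift) (simp add: sum_distrib_left)
  have G0: "G > 0" unfolding G_def using x by (intro sum_pos) (auto simp: m_def)
  have H0: "H > 0" unfolding GH using G0 x by (simp add: add_pos_pos)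
  have "real m * y ^ m \<le> real m * y ^ k"
    using y by (intro mult_left_mono power_decreasing) (auto simp: m_def)
  also have "\<dots> \<le> G" using sum_even_powers_ge[of k y] by (simp add: m_def G_def y(1))
  finally have g: "real m * y ^ m \<le> G" .
  have h: "real (Suc m) * y ^ m \<le> H" using sum_even_powers_ge[of m y] by (simp only: H_def y(1))
  have "(real m * y ^ m) * (real (Suc m) * y ^ m) \<le> G * H"
    by (rule mult_mono[OF g h]) (use G0 y in auto)
  moreover have "y ^ m * y ^ m = x ^ m"
    by (simp add: y(1)[symmetric] power2_eq_square power_mult_distrib)
  ultimately have GHge: "real m * real (Suc m) * x ^ m \<le> G * H"
    by (simp only: mult_ac)
  have w: "lambert_weight x k = (1 / real m - x ^ m / G) / (1 - x)"
    and w': "lambert_weight x (Suc k) = (1 / real (Suc m) - x ^ Suc m / H) / (1 - x)"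
    unfolding lambert_weight_def m_def[symmetric] one_diff_power_eq G_def[symmetric] H_def[symmetric]
    by (simp_all only: diff_divide_distrib divide_divide_eq_left mult.commute[of "1 - x"])
  have "x ^ m / G - x ^ Suc m / H = x ^ m / (G * H)"
    using G0 H0 GH by (simp add: field_simps)
  also have "\<dots> \<le> 1 / (real m * real (Suc m))"
    using GHge G0 H0 by (simp add: divide_simps m_def mult_ac del: of_nat_Suc)
  also have "\<dots> = 1 / real m - 1 / real (Suc m)"
    by (simp add: field_simps m_def)
  finally have "1 / real (Suc m) - x ^ Suc m / H \<le> 1 / real m - x ^ m / G" by simp
  then show "lambert_weight x (Suc k) \<le> lambert_weight x k"
    unfolding w w' using x by (intro divide_right_mono) auto
qed

lemma lambert_weight_0:
  assumes "0 < x" "x < 1"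
  shows "lambert_weight x 0 = 1"
  using assms by (simp add: lambert_weight_def flip: diff_divide_distrib)

lemma lambert_weight_tendsto_0:
  assumes "0 < x" "x < 1"
  shows "lambert_weight x \<longlonglongrightarrow> 0"
proof -
  have "(\<lambda>k. (1 / (1 - x)) * inverse (real (Suc k)) - x ^ Suc k / (1 - x ^ Suc k)) \<longlonglongrightarrow> (1 / (1 - x)) * 0 - 0 / (1 - 0)"
    using assms by (intro tendsto_intros LIMSEQ_inverse_real_of_nat LIMSEQ_Suc[OF LIMSEQ_realpow_zero]) auto
  moreover have "(\<lambda>k. (1 / (1 - x)) * inverse (real (Suc k)) - x ^ Suc k / (1 - x ^ Suc k)) = lambert_weight x"
    by (rule ext) (simp add: lambert_weight_def divide_simps)
  ultimately show ?thesis by simp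
qed

text \<open>Divisors of \<open>p^k M\<close> factor uniquely as \<open>p^i d\<close> with \<open>i \<le> k\<close> and \<open>d dvd M\<close>.\<close>

lemma sum_divisors_prime_power_mult:
  fixes c :: "nat \<Rightarrow> real"
  assumes p: "prime p" "\<not> p dvd M" and M: "M > 0" and mult: "\<And>a b. c (a * b) = c a * c b" and c1: "c 1 = 1"
  shows "(\<Sum>d | d dvd p ^ k * M. c d) = (\<Sum>i\<le>k. c p ^ i) * (\<Sum>d | d dvd M. c d)"
proof -
  have cpow: "c (p ^ i) = c p ^ i" for i using c1 by (induction i) (auto simp: mult)
  have p0: "p > 0" using p by (simp add: prime_gt_0_nat)
  have "bij_betw (\<lambda>(i, d). p ^ i * d) ({..k} \<times> {d. d dvd M}) {d. d dvd p ^ k * M}"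
    unfolding bij_betw_def
  proof
    show "inj_on (\<lambda>(i, d). p ^ i * d) ({..k} \<times> {d. d dvd M})"
    proof (rule inj_onI, clarify)
      fix i d j e assume d: "d dvd M" and e: "e dvd M" and eq: "p ^ i * d = p ^ j * e"
      have nd: "\<not> p dvd d" "\<not> p dvd e" using d e p(2) dvd_trans by blast+
      have "multiplicity p (p ^ i * d) = i" "multiplicity p (p ^ j * e) = j"
        using p(1) nd by (auto intro!: multiplicity_eqI simp: prime_gt_0_nat) 
      then have "i = j" using eq by simp
      then show "i = j \<and> d = e" using eq p0 by simp
    qed
    show "(\<lambda>(i, d). p ^ i * d) ` ({..k} \<times> {d. d dvd M}) = {d. d dvd p ^ k * M}"
    proof (intro equalityI subsetI)
      fix e assume "e \<in> {d. d dvd p ^ k * M}"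
      then obtain b d where bd: "e = b * d" "b dvd p ^ k" "d dvd M"
        using division_decomp[of e "p ^ k" M] by auto
      obtain i where "i \<le> k" "b = p ^ i"
        using bd(2) p(1) divides_primepow_nat by blast
      then show "e \<in> (\<lambda>(i, d). p ^ i * d) ` ({..k} \<times> {d. d dvd M})"
        using bd by auto
    qed (auto intro: mult_dvd_mono le_imp_power_dvd)
  qed
  then have "(\<Sum>d | d dvd p ^ k * M. c d) = (\<Sum>(i, d)\<in>{..k} \<times> {d. d dvd M}. c (p ^ i * d))"
    by (simp add: sum.reindex_bij_betw[symmetric] case_prod_unfold)
  also have "\<dots> = (\<Sum>(i, d)\<in>{..k} \<times> {d. d dvd M}. c p ^ i * c d)"
    by (simp only: mult cpow)
  also have "\<dots> = (\<Sum>i\<le>k. c p ^ i) * (\<Sum>d | d dvd M. c d)"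
    by (simp add: sum_product sum.cartesian_product)
  finally show ?thesis .
qed

lemma sum_powers_sign:
  fixes s :: real
  assumes "s \<in> {-1, 0, 1}"
  shows "(\<Sum>i\<le>k. s ^ i) \<ge> 0" and "even k \<Longrightarrow> (\<Sum>i\<le>k. s ^ i) \<ge> 1"
proof -
  have m1: "(\<Sum>i\<le>k. (-1 :: real) ^ i) = (if even k then 1 else 0)" by (induction k) auto
  have m0: "(\<Sum>i\<le>k. (0 :: real) ^ i) = 1" by (induction k) auto
  show "(\<Sum>i\<le>k. s ^ i) \<ge> 0" and "even k \<Longrightarrow> (\<Sum>i\<le>k. s ^ i) \<ge> 1"
    using assms m1 m0 by auto
qed

text \<open>Peel off one prime power at a time: each contributes the factor \<open>1 + s + \<dots> + s^k\<close> with
\<open>s \<in> {-1, 0, 1}\<close>, which is nonnegative, and at least \<open>1\<close> for the even exponents \<open>k\<close> found in a square.\<close>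

lemma sum_divisors_sign_char:
  fixes c :: "nat \<Rightarrow> real"
  assumes mult: "\<And>a b. c (a * b) = c a * c b" and c1: "c 1 = 1" and val: "\<And>a. c a \<in> {-1, 0, 1}"
    and N: "N > 0"
  shows "(\<Sum>d | d dvd N. c d) \<ge> 0 \<and> ((\<exists>m. N = m\<^sup>2) \<longrightarrow> (\<Sum>d | d dvd N. c d) \<ge> 1)"
  using N
proof (induction N rule: less_induct)
  case (less N)
  show ?case
  proof (cases "N = 1")
    case True
    then show ?thesis using c1 by simp
  next
    case False
    then obtain p where p: "prime p" "p dvd N" using prime_factor_nat by blast
    have "\<not> is_unit p" using p(1) not_prime_unit by blast
    then obtain M where NM: "N = p ^ multiplicity p N * M" and pM: "\<not> p dvd M"
      using multiplicity_decompose'[of N p] less.prems by auto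
    define k where "k = multiplicity p N"
    have N: "N = p ^ k * M" using NM by (simp add: k_def)
    have M0: "M > 0" using less.prems N by (cases "M = 0") auto
    have "k > 0" using p pM N by (cases "k = 0") auto
    then have "p ^ k > 1" by (intro one_less_power prime_gt_1_nat p(1))
    then have "M < N" using M0 by (simp add: N)
    from less.IH[OF this M0]
    have IH: "(\<Sum>d | d dvd M. c d) \<ge> 0" "\<And>m. M = m\<^sup>2 \<Longrightarrow> (\<Sum>d | d dvd M. c d) \<ge> 1" by auto
    have eq: "(\<Sum>d | d dvd N. c d) = (\<Sum>i\<le>k. c p ^ i) * (\<Sum>d | d dvd M. c d)"
      unfolding N by (rule sum_divisors_prime_power_mult[OF p(1) pM M0 mult c1])
    have "(\<Sum>d | d dvd N. c d) \<ge> 1" if m: "N = m\<^sup>2" for m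
    proof -
      have "m > 0" using m less.prems by (cases "m = 0") auto
      then obtain m' where m': "m = p ^ multiplicity p m * m'" "\<not> p dvd m'"
        using multiplicity_decompose'[of m p] \<open>\<not> is_unit p\<close> by auto
      define j where "j = multiplicity p m"
      have "N = p ^ (2 * j) * m'\<^sup>2"
        unfolding m by (subst m'(1)) (simp add: j_def power_mult_distrib power_mult mult.commute)
      moreover have "\<not> p dvd m'\<^sup>2" using m'(2) p(1) prime_dvd_power by blast
      ultimately have "multiplicity p N = 2 * j"
        using p(1) by (auto intro!: multiplicity_eqI simp: prime_gt_0_nat)
      then have k: "k = 2 * j" by (simp add: k_def)
      then have "M = m'\<^sup>2" using N \<open>N = p ^ (2 * j) * m'\<^sup>2\<close> p(1) by (simp add: prime_gt_0_nat)
      then have "1 * 1 \<le> (\<Sum>i\<le>k. c p ^ i) * (\<Sum>d | d dvd M. c d)"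
        using IH(2) sum_powers_sign(2)[OF val, of k p] k by (intro mult_mono) auto
      then show ?thesis unfolding eq by simp
    qed
    moreover have "(\<Sum>d | d dvd N. c d) \<ge> 0"
      unfolding eq using IH(1) sum_powers_sign(1)[OF val] by (intro mult_nonneg_nonneg)
    ultimately show ?thesis by blast
  qed
qed

text \<open>The geometric series over the multiples of \<open>m\<close>, truncated at \<open>M\<close>. The error is uniform in \<open>m\<close>, so
that it remains negligible after summation over \<open>m \<le> M\<close>.\<close>

lemma sum_powers_multiples:
  fixes x :: real
  assumes x: "0 < x" "x < 1" and m: "m > 0"
  shows "\<bar>(\<Sum>N | N \<in> {1..M} \<and> m dvd N. x ^ N) - x ^ m / (1 - x ^ m)\<bar> \<le> x ^ M / (1 - x)"
proof -
  define q where "q = M div m"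
  have xm: "x ^ m < 1" using power_decreasing[of 1 m x] x m by simp
  have "bij_betw (\<lambda>j. m * Suc j) {..<q} {N. N \<in> {1..M} \<and> m dvd N}"
    unfolding bij_betw_def
  proof
    show "inj_on (\<lambda>j. m * Suc j) {..<q}" using m by (auto intro: inj_onI)
    show "(\<lambda>j. m * Suc j) ` {..<q} = {N. N \<in> {1..M} \<and> m dvd N}"
    proof (intro equalityI subsetI)
      fix N assume "N \<in> {N. N \<in> {1..M} \<and> m dvd N}"
      then obtain i where i: "N = m * i" "i > 0" "m * i \<le> M" by (auto simp: dvd_def intro: Nat.gr0I)
      then have "i \<le> q" unfolding q_def using m by (simp add: less_eq_div_iff_mult_less_eq mult.commute)
      then show "N \<in> (\<lambda>j. m * Suc j) ` {..<q}" using i by (intro image_eqI[of _ _ "i - 1"]) auto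
    next
      fix N assume "N \<in> (\<lambda>j. m * Suc j) ` {..<q}"
      then obtain j where "j \<in> {..<q}" and N: "N = m * Suc j" by blast
      then have j: "Suc j \<le> q" by simp
      then have "m * Suc j \<le> M" unfolding q_def using m by (simp only: less_eq_div_iff_mult_less_eq mult.commute)
      then show "N \<in> {N. N \<in> {1..M} \<and> m dvd N}" using N m by simp
    qed
  qed
  then have "(\<Sum>N | N \<in> {1..M} \<and> m dvd N. x ^ N) = (\<Sum>j<q. x ^ (m * Suc j))"
    by (rule sum.reindex_bij_betw[symmetric])
  also have "\<dots> = x ^ m * (\<Sum>j<q. (x ^ m) ^ j)"
    by (simp add: sum_distrib_left power_add power_mult)
  also have "\<dots> = x ^ m / (1 - x ^ m) - (x ^ m) ^ Suc q / (1 - x ^ m)"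
    using xm by (simp add: sum_gp_strict diff_divide_distrib right_diff_distrib)
  finally have eq: "\<bar>(\<Sum>N | N \<in> {1..M} \<and> m dvd N. x ^ N) - x ^ m / (1 - x ^ m)\<bar> = (x ^ m) ^ Suc q / (1 - x ^ m)"
    using x by (simp add: power_le_one del: power_Suc)
  have "M \<le> m * Suc q" using m unfolding q_def
    by (metis dividend_less_times_div less_imp_le_nat mult_Suc_right add.commute)
  then have "(x ^ m) ^ Suc q \<le> x ^ M" unfolding power_mult[symmetric]
    using x by (intro power_decreasing) auto
  moreover have "1 - x \<le> 1 - x ^ m" using x m power_decreasing[of 1 m x] by simp
  ultimately show ?thesis unfolding eq using x by (intro frac_le) auto
qed

text \<open>Monsky's argument. If the series vanished, summation by parts with \<open>lambert_weight\<close> would bound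
the Lambert series by \<open>B\<close> for all \<open>x < 1\<close>. As a power series it dominates \<open>\<Sum>k\<le>K. x^(k\<^sup>2)\<close>, whose limit at
\<open>x = 1\<close> is \<open>K\<close>, for every \<open>K\<close>. The two expansions are compared through partial sums up to \<open>M\<close>, at the cost of
an error \<open>M x^M / (1 - x)\<close> that tends to \<open>0\<close>.\<close>

lemma real_char_series_nonzero:
  fixes c :: "nat \<Rightarrow> real"
  assumes mult: "\<And>a b. c (a * b) = c a * c b" and c1: "c 1 = 1" and val: "\<And>a. c a \<in> {-1, 0, 1}"
    and bnd: "\<And>N. \<bar>\<Sum>m<N. c (Suc m)\<bar> \<le> B"
  shows "\<not> (\<lambda>k. c (Suc k) / real (Suc k)) sums 0"
proof
  assume zero: "(\<lambda>k. c (Suc k) / real (Suc k)) sums 0"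
  have bound: "(\<Sum>k=1..K. x ^ (k\<^sup>2)) \<le> B" if x: "0 < x" "x < 1" for x :: real and K :: nat
  proof -
    define l where "l k = x ^ Suc k / (1 - x ^ Suc k)" for k
    have "norm (\<Sum>m<N. complex_of_real (c (Suc m))) \<le> B" for N
      using bnd[of N] by (simp flip: of_real_sum)
    from sums_by_parts_decseq[OF this decseq_lambert_weight[OF x] lambert_weight_tendsto_0[OF x]]
    obtain S where S: "(\<lambda>k. complex_of_real (lambert_weight x k) * of_real (c (Suc k))) sums S"
      and nS: "norm S \<le> B * lambert_weight x 0" by blast
    have "(\<lambda>k. (1 / (1 - x)) * (c (Suc k) / real (Suc k)) - Re (of_real (lambert_weight x k) * of_real (c (Suc k)))) sums ((1 / (1 - x)) * 0 - Re S)"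
      by (intro sums_diff sums_mult zero sums_Re S)
    moreover have "(1 / (1 - x)) * (c (Suc k) / real (Suc k)) - Re (of_real (lambert_weight x k) * of_real (c (Suc k))) = c (Suc k) * l k" for k
      by (simp add: lambert_weight_def l_def algebra_simps)
    ultimately have sl: "(\<lambda>k. c (Suc k) * l k) sums (- Re S)" by simp
    have "- Re S \<le> B" using nS complex_Re_le_cmod[of "- S"] by (simp add: lambert_weight_0[OF x])
    have fin: "(\<Sum>k=1..K. x ^ (k\<^sup>2)) \<le> (\<Sum>k<M. c (Suc k) * l k) + real M * (x ^ M / (1 - x))" if M: "K\<^sup>2 \<le> M" for M
    proof -
      have "(\<Sum>k=1..K. x ^ (k\<^sup>2)) = (\<Sum>N\<in>(\<lambda>k. k\<^sup>2) ` {1..K}. x ^ N)"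
        by (subst sum.reindex) (auto intro!: inj_onI)
      also have "\<dots> \<le> (\<Sum>N\<in>(\<lambda>k. k\<^sup>2) ` {1..K}. (\<Sum>d | d dvd N. c d) * x ^ N)"
      proof (rule sum_mono)
        fix N assume "N \<in> (\<lambda>k. k\<^sup>2) ` {1..K}"
        then have "N > 0" "\<exists>m. N = m\<^sup>2" by auto
        then have "1 \<le> (\<Sum>d | d dvd N. c d)" using sum_divisors_sign_char[OF mult c1 val] by blast
        then show "x ^ N \<le> (\<Sum>d | d dvd N. c d) * x ^ N" using x by simp
      qed
      also have "\<dots> \<le> (\<Sum>N=1..M. (\<Sum>d | d dvd N. c d) * x ^ N)"
      proof (rule sum_mono2)
        show "(\<lambda>k. k\<^sup>2) ` {1..K} \<subseteq> {1..M}"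
          using M by (auto intro: order.trans[OF power_mono])
        fix N assume "N \<in> {1..M} - (\<lambda>k. k\<^sup>2) ` {1..K}"
        then show "0 \<le> (\<Sum>d | d dvd N. c d) * x ^ N"
          using sum_divisors_sign_char[OF mult c1 val, of N] x by simp
      qed auto
      also have "\<dots> = (\<Sum>N=1..M. \<Sum>d\<in>{1..M}. if d dvd N then c d * x ^ N else 0)"
      proof (rule sum.cong[OF refl])
        fix N assume N: "N \<in> {1..M}"
        have "{d. d dvd N} = {d\<in>{1..M}. d dvd N}"
          using N by (auto dest: dvd_imp_le intro: Nat.gr0I)
        moreover have "(\<Sum>d\<in>{d\<in>{1..M}. d dvd N}. c d * x ^ N) = (\<Sum>d\<in>{1..M}. if d dvd N then c d * x ^ N else 0)"
          by (rule sum.inter_filter) simp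
        ultimately show "(\<Sum>d | d dvd N. c d) * x ^ N = (\<Sum>d\<in>{1..M}. if d dvd N then c d * x ^ N else 0)"
          by (simp only: sum_distrib_right)
      qed
      also have "\<dots> = (\<Sum>d=1..M. c d * (\<Sum>N | N \<in> {1..M} \<and> d dvd N. x ^ N))"
        by (subst sum.swap) (simp add: sum.inter_filter[symmetric] sum_distrib_left)
      also have "\<dots> \<le> (\<Sum>d=1..M. c d * (x ^ d / (1 - x ^ d)) + x ^ M / (1 - x))"
      proof (rule sum_mono)
        fix d assume "d \<in> {1..M}"
        then have "\<bar>(\<Sum>N | N \<in> {1..M} \<and> d dvd N. x ^ N) - x ^ d / (1 - x ^ d)\<bar> \<le> x ^ M / (1 - x)"
          by (intro sum_powers_multiples[OF x]) auto
        then show "c d * (\<Sum>N | N \<in> {1..M} \<and> d dvd N. x ^ N) \<le> c d * (x ^ d / (1 - x ^ d)) + x ^ M / (1 - x)"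
          using val[of d] by auto
      qed
      also have "\<dots> = (\<Sum>k<M. c (Suc k) * l k) + real M * (x ^ M / (1 - x))"
        by (simp add: sum.distrib l_def sum.atLeast1_atMost_eq del: power_Suc)
      finally show ?thesis .
    qed
    have "(\<lambda>M. (\<Sum>k<M. c (Suc k) * l k) + real M * x ^ M * (1 / (1 - x))) \<longlonglongrightarrow> - Re S + 0 * (1 / (1 - x))"
      using sl x by (intro tendsto_intros powser_times_n_limit_0) (auto simp: sums_def)
    then have "(\<lambda>M. (\<Sum>k<M. c (Suc k) * l k) + real M * (x ^ M / (1 - x))) \<longlonglongrightarrow> - Re S" by simp
    then have "(\<Sum>k=1..K. x ^ (k\<^sup>2)) \<le> - Re S"
      by (rule LIMSEQ_le_const) (use fin in blast)
    then show ?thesis using \<open>- Re S \<le> B\<close> by simp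
  qed
  have "real K \<le> B" for K :: nat
  proof (rule tendsto_upperbound)
    have "((\<lambda>x. \<Sum>k=1..K. x ^ (k\<^sup>2)) \<longlongrightarrow> (\<Sum>k=1..K. 1 ^ (k\<^sup>2))) (at_left (1::real))"
      by (intro tendsto_intros)
    then show "((\<lambda>x. \<Sum>k=1..K. x ^ (k\<^sup>2)) \<longlongrightarrow> real K) (at_left (1::real))" by simp
    show "\<forall>\<^sub>F x in at_left 1. (\<Sum>k=1..K. x ^ (k\<^sup>2)) \<le> B"
      using eventually_at_left_real[OF less_numeral_extra(1)] by eventually_elim (use bound in auto)
  qed auto
  then show False using reals_Archimedean2[of B] by (meson not_le)
qed

section \<open>Complex characters\<close>

text \<open>Removing the multiples of a prime \<open>q\<close> multiplies the series by \<open>1 - h q\<close>.\<close>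

lemma sums_coprime_part_euler:
  fixes h :: "nat \<Rightarrow> complex"
  assumes mult: "\<And>a b. h (a * b) = h a * h b" and L: "(\<lambda>k. h (Suc k)) sums L"
    and P: "finite P" "\<And>p. p \<in> P \<Longrightarrow> prime p"
  shows "(\<lambda>k. if \<exists>p\<in>P. p dvd Suc k then 0 else h (Suc k)) sums (L * (\<Prod>p\<in>P. 1 - h p))"
  using P
proof (induction P rule: finite_induct)
  case empty
  then show ?case using L by simp
next
  case (insert q P)
  define u where "u m = (if \<exists>p\<in>P. p dvd m then 0 else h m)" for m
  define S where "S = L * (\<Prod>p\<in>P. 1 - h p)"
  have IH: "(\<lambda>k. u (Suc k)) sums S"
    unfolding u_def S_def by (rule insert.IH) (use insert.prems in auto)
  have q: "prime q" using insert.prems by auto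
  have "(\<exists>p\<in>P. p dvd q * m) \<longleftrightarrow> (\<exists>p\<in>P. p dvd m)" for m
    by (rule prime_divisor_in_set_mult_iff[OF q]) (use insert in auto)
  then have "u (q * m) = h q * u m" for m
    by (simp add: u_def mult)
  then have "(\<lambda>k. u (q * Suc k)) sums (h q * S)"
    using sums_mult[OF IH, of "h q"] by (simp only:)
  from sums_remove_multiples[OF prime_gt_0_nat[OF q] IH this]
  have "(\<lambda>k. if q dvd Suc k then 0 else u (Suc k)) sums (S - h q * S)" .
  moreover have "(if q dvd Suc k then 0 else u (Suc k))
      = (if \<exists>p\<in>insert q P. p dvd Suc k then 0 else h (Suc k))" for k
    by (simp add: u_def)
  moreover have "S - h q * S = L * (\<Prod>p\<in>insert q P. 1 - h p)"
    using insert.hyps by (simp add: S_def algebra_simps)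
  ultimately show ?case by simp
qed

text \<open>After the primes up to \<open>N\<close> are sieved out, only the term \<open>1\<close> and terms beyond \<open>N\<close> remain.
The Euler product is kept in the form that multiplies the series, so that no factor is inverted and the
product need not be known to converge by itself.\<close>

lemma euler_product_tendsto:
  fixes h :: "nat \<Rightarrow> complex"
  assumes mult: "\<And>a b. h (a * b) = h a * h b" and h1: "h 1 = 1"
    and abs: "summable (\<lambda>k. norm (h (Suc k)))" and L: "(\<lambda>k. h (Suc k)) sums L"
  shows "(\<lambda>N. L * (\<Prod>p | prime p \<and> p \<le> N. 1 - h p)) \<longlonglongrightarrow> 1"
proof -
  define a where "a k = norm (h (Suc k))" for k
  have sa: "summable a" using abs by (simp add: a_def[abs_def])
  have bound: "norm (L * (\<Prod>p | prime p \<and> p \<le> N. 1 - h p) - 1) \<le> suminf a - (\<Sum>k<N. a k)" if N: "N > 0" for N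
  proof -
    let ?P = "{p. prime p \<and> p \<le> N}"
    define s where "s k = (if \<exists>p\<in>?P. p dvd Suc k then 0 else h (Suc k))" for k
    have s: "s sums (L * (\<Prod>p\<in>?P. 1 - h p))"
      unfolding s_def by (rule sums_coprime_part_euler[OF mult L]) (auto intro: finite_subset[of _ "{..N}"])
    have "s 0 = 1" using h1 by (auto simp: s_def)
    moreover have "s (Suc k) = 0" if k: "Suc k < N" for k
    proof -
      obtain p where "prime p" "p dvd Suc (Suc k)" using prime_factor_nat[of "Suc (Suc k)"] by auto
      moreover from this have "p \<le> N" using dvd_imp_le[of p "Suc (Suc k)"] k by simp
      ultimately show ?thesis by (auto simp: s_def)
    qed
    ultimately have "(\<Sum>k<N. s k) = 1"
      using sum.lessThan_Suc_shift[of s "N - 1"] N by simp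
    then have tail: "(\<lambda>k. s (k + N)) sums (L * (\<Prod>p\<in>?P. 1 - h p) - 1)"
      using sums_iff_shift'[of s N "L * (\<Prod>p\<in>?P. 1 - h p)"] s by simp
    have sb: "norm (s (k + N)) \<le> a (k + N)" for k by (simp add: s_def a_def)
    have sat: "summable (\<lambda>k. a (k + N))" using sa by simp
    have ss: "summable (\<lambda>k. norm (s (k + N)))"
      by (rule summable_comparison_test'[OF sat, of 0]) (use sb in auto)
    have "norm (\<Sum>k. s (k + N)) \<le> (\<Sum>k. norm (s (k + N)))" by (rule summable_norm[OF ss])
    also have "\<dots> \<le> (\<Sum>k. a (k + N))" by (rule suminf_le[OF sb ss sat])
    also have "\<dots> = suminf a - (\<Sum>k<N. a k)" by (rule suminf_minus_initial_segment[OF sa])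
    finally show ?thesis using sums_unique[OF tail] by simp
  qed
  have "(\<lambda>N. suminf a - (\<Sum>k<N. a k)) \<longlonglongrightarrow> suminf a - suminf a"
    by (intro tendsto_intros summable_LIMSEQ sa)
  then have lim: "(\<lambda>N. suminf a - (\<Sum>k<N. a k)) \<longlonglongrightarrow> 0" by simp
  have "(\<lambda>N. L * (\<Prod>p | prime p \<and> p \<le> N. 1 - h p) - 1) \<longlonglongrightarrow> 0"
  proof (rule Lim_null_comparison[OF _ lim])
    show "\<forall>\<^sub>F N in sequentially. norm (L * (\<Prod>p | prime p \<and> p \<le> N. 1 - h p) - 1) \<le> suminf a - (\<Sum>k<N. a k)"
      using eventually_gt_at_top[of "0::nat"] by eventually_elim (rule bound)
  qed
  then show ?thesis by (simp add: LIM_zero_iff)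
qed

text \<open>With \<open>u = z^k\<close> on the unit circle, \<open>3 + 4 Re u + Re (u\<^sup>2) = 2 (1 + Re u)\<^sup>2 \<ge> 0\<close>. Inserted into the series
of \<open>ln \<bar>1 - t w\<bar> = -\<Sum>k. t^k Re (w^k) / k\<close> at \<open>w = 1, z, z\<^sup>2\<close>, this shows that the logarithm of the product
is at most \<open>0\<close>.\<close>

lemma three_four_one:
  fixes z :: complex
  assumes t: "0 < t" "t < 1" and z: "norm z = 0 \<or> norm z = 1"
  shows "(1 - t) ^ 3 * norm (1 - of_real t * z) ^ 4 * norm (1 - of_real t * z\<^sup>2) \<le> 1"
proof (cases "norm z = 0")
  case True
  then show ?thesis using t by (simp add: power_le_one)
next
  case False
  then have z: "norm z = 1" using z by simp
  have ser: "(\<lambda>k. - (t ^ k / real k) * Re (w ^ k)) sums ln (norm (1 - of_real t * w))"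
    and pos: "norm (1 - of_real t * w) > 0" if w: "norm w = 1" for w :: complex
  proof -
    have n: "norm (- (of_real t * w)) < 1" using w t by (simp add: norm_mult)
    then have "of_real t * w \<noteq> 1" by (metis less_irrefl norm_minus_cancel norm_one)
    then show p: "norm (1 - of_real t * w) > 0" by simp
    have "(\<lambda>k. (-1) ^ Suc k / of_nat k * (- (of_real t * w)) ^ k) sums Ln (1 + - (of_real t * w))"
      by (rule Ln_series[OF n])
    then have "(\<lambda>k. Re ((-1) ^ Suc k / of_nat k * (- (of_real t * w)) ^ k)) sums Re (Ln (1 + - (of_real t * w)))"
      by (rule sums_Re)
    moreover have "(-1) ^ Suc k / of_nat k * (- (of_real t * w)) ^ k = of_real (- (t ^ k / real k)) * w ^ k" for k
    proof -
      have "(- (of_real t * w)) ^ k = (-1) ^ k * (of_real t ^ k * w ^ k)"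
        by (simp add: power_minus[of "of_real t * w"] power_mult_distrib)
      moreover have "(-1) ^ Suc k * (-1) ^ k = (-1 :: complex)"
        by (simp flip: power_add power_mult_distrib)
      ultimately have "(-1) ^ Suc k * (- (of_real t * w)) ^ k = - (of_real t ^ k * w ^ k)"
        by (simp only: mult.assoc[symmetric] mult_minus1 mult_minus_left mult_1_left)
      then show ?thesis by (simp add: field_simps)
    qed
    ultimately have "(\<lambda>k. Re (of_real (- (t ^ k / real k)) * w ^ k)) sums Re (Ln (1 + - (of_real t * w)))"
      by (simp only:)
    moreover have "Re (Ln (1 + - (of_real t * w))) = ln (norm (1 - of_real t * w))"
      using p by (simp add: Re_Ln)
    moreover have "Re (of_real r * v) = r * Re v" for r v by simp
    ultimately show "(\<lambda>k. - (t ^ k / real k) * Re (w ^ k)) sums ln (norm (1 - of_real t * w))"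
      by (simp only:)
  qed
  have z2: "norm (z\<^sup>2) = 1" by (simp add: norm_power z)
  have series: "(\<lambda>k. 3 * (- (t ^ k / real k) * Re (1 ^ k)) + 4 * (- (t ^ k / real k) * Re (z ^ k))
        + - (t ^ k / real k) * Re ((z\<^sup>2) ^ k))
      sums (3 * ln (norm (1 - of_real t * (1::complex))) + 4 * ln (norm (1 - of_real t * z))
        + ln (norm (1 - of_real t * z\<^sup>2)))"
    by (intro sums_add sums_mult ser z z2) auto
  have nonpos: "3 * (- (t ^ k / real k) * Re (1 ^ k)) + 4 * (- (t ^ k / real k) * Re (z ^ k))
        + - (t ^ k / real k) * Re ((z\<^sup>2) ^ k) \<le> 0" for k
  proof -
    have "(Re (z ^ k))\<^sup>2 + (Im (z ^ k))\<^sup>2 = (norm (z ^ k))\<^sup>2" by (simp add: cmod_power2)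
    then have n: "(Im (z ^ k))\<^sup>2 = 1 - (Re (z ^ k))\<^sup>2" using z by (simp add: norm_power)
    have "(z\<^sup>2) ^ k = z ^ k * z ^ k" by (simp add: power2_eq_square power_mult_distrib)
    then have "Re ((z\<^sup>2) ^ k) = (Re (z ^ k))\<^sup>2 - (Im (z ^ k))\<^sup>2" by (simp add: power2_eq_square)
    then have r: "Re ((z\<^sup>2) ^ k) = 2 * (Re (z ^ k))\<^sup>2 - 1" using n by simp
    have "3 * (- (t ^ k / real k) * Re (1 ^ k)) + 4 * (- (t ^ k / real k) * Re (z ^ k))
        + - (t ^ k / real k) * Re ((z\<^sup>2) ^ k) = - (t ^ k / real k) * (2 * (1 + Re (z ^ k))\<^sup>2)"
      unfolding r by (simp add: power2_eq_square algebra_simps)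
    then show ?thesis using t by (simp add: zero_le_mult_iff)
  qed
  have le: "3 * ln (norm (1 - of_real t * (1::complex))) + 4 * ln (norm (1 - of_real t * z))
        + ln (norm (1 - of_real t * z\<^sup>2)) \<le> 0"
    by (rule sums_le[OF nonpos series sums_zero])
  have "norm (1 - of_real t * (1::complex)) = 1 - t"
    using t norm_of_real[of "1 - t", where 'a = complex] by simp
  then have "ln ((1 - t) ^ 3 * norm (1 - of_real t * z) ^ 4 * norm (1 - of_real t * z\<^sup>2)) \<le> 0"
    using le t pos[OF z] pos[OF z2] by (simp add: ln_mult ln_realpow)
  then show ?thesis using t pos[OF z] pos[OF z2] by (subst (asm) ln_le_zero_iff) auto
qed

text \<open>Both bounds come from \<open>exp r \<ge> 1 + r\<close>, as \<open>x powr -\<delta> = y powr -\<delta> * exp (\<delta> (ln y - ln x))\<close>.\<close>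

lemma powr_minus_diff:
  fixes x y \<delta> :: real
  assumes "0 < x" "x \<le> y" "0 \<le> \<delta>"
  shows "x powr (-\<delta>) - y powr (-\<delta>) \<le> x powr (-\<delta>) * (\<delta> * (ln y - ln x))"
    and "y powr (-\<delta>) * (\<delta> * (ln y - ln x)) \<le> x powr (-\<delta>) - y powr (-\<delta>)"
proof -
  define r where "r = \<delta> * (ln y - ln x)"
  have "y powr (-\<delta>) = x powr (-\<delta>) * exp (- r)"
    using assms by (simp add: powr_def r_def algebra_simps flip: exp_add)
  moreover have "x powr (-\<delta>) * (1 - r) \<le> x powr (-\<delta>) * exp (- r)"
    using exp_ge_add_one_self[of "- r"] by (intro mult_left_mono) auto
  ultimately have "x powr (-\<delta>) - y powr (-\<delta>) \<le> x powr (-\<delta>) * r"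
    by (simp add: algebra_simps)
  then show "x powr (-\<delta>) - y powr (-\<delta>) \<le> x powr (-\<delta>) * (\<delta> * (ln y - ln x))"
    by (simp only: r_def)
  have "x powr (-\<delta>) = y powr (-\<delta>) * exp r"
    using assms by (simp add: powr_def r_def algebra_simps flip: exp_add)
  moreover have "y powr (-\<delta>) * (1 + r) \<le> y powr (-\<delta>) * exp r"
    using exp_ge_add_one_self[of r] by (intro mult_left_mono) auto
  ultimately have "y powr (-\<delta>) * r \<le> x powr (-\<delta>) - y powr (-\<delta>)"
    by (simp add: algebra_simps)
  then show "y powr (-\<delta>) * (\<delta> * (ln y - ln x)) \<le> x powr (-\<delta>) - y powr (-\<delta>)"
    by (simp only: r_def)
qed

text \<open>The partial sums telescope against \<open>(x powr -\<delta>) / \<delta>\<close>, an antiderivative of \<open>-x powr -(1 + \<delta>)\<close>.\<close>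

lemma zeta_bound:
  fixes \<delta> :: real
  assumes \<delta>: "\<delta> > 0"
  shows "summable (\<lambda>k. real (Suc k) powr (- (1 + \<delta>)))"
    and "(\<Sum>k. real (Suc k) powr (- (1 + \<delta>))) \<le> 1 + 1 / \<delta>"
proof -
  show sm: "summable (\<lambda>k. real (Suc k) powr (- (1 + \<delta>)))"
    using \<delta> by (subst summable_Suc_iff[of "\<lambda>k. real k powr (- (1 + \<delta>))"]) (simp add: summable_real_powr_iff)
  have part: "(\<Sum>k<Suc N. real (Suc k) powr (- (1 + \<delta>))) \<le> 1 + (1 - real (Suc N) powr (-\<delta>)) / \<delta>" for N
  proof (induction N)
    case (Suc N)
    define x where "x = real (Suc N)"
    have x: "x > 0" by (simp add: x_def)
    have y: "real (Suc (Suc N)) = x + 1" by (simp add: x_def)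
    have "ln (x / (x + 1)) \<le> x / (x + 1) - 1" using x by (intro ln_le_minus_one) auto
    then have "1 / (x + 1) \<le> ln (x + 1) - ln x" using x by (simp add: ln_div field_simps)
    then have "(x + 1) powr (-\<delta>) * (\<delta> * (1 / (x + 1))) \<le> (x + 1) powr (-\<delta>) * (\<delta> * (ln (x + 1) - ln x))"
      using \<delta> by (intro mult_left_mono) auto
    also have "\<dots> \<le> x powr (-\<delta>) - (x + 1) powr (-\<delta>)"
      by (rule powr_minus_diff(2)) (use x \<delta> in auto)
    finally have "\<delta> * ((x + 1) powr (-\<delta>) / (x + 1)) \<le> x powr (-\<delta>) - (x + 1) powr (-\<delta>)"
      by (simp add: mult_ac)
    moreover have "(x + 1) powr (- (1 + \<delta>)) = (x + 1) powr (-\<delta>) / (x + 1)"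
      using x powr_diff[of "x + 1" "- \<delta>" 1] by (simp add: minus_diff_commute)
    ultimately have "(x + 1) powr (- (1 + \<delta>)) \<le> (x powr (-\<delta>) - (x + 1) powr (-\<delta>)) / \<delta>"
      using \<delta> by (simp add: field_simps)
    then have "(\<Sum>k<Suc (Suc N). real (Suc k) powr (- (1 + \<delta>)))
        \<le> (1 + (1 - x powr (-\<delta>)) / \<delta>) + (x powr (-\<delta>) - (x + 1) powr (-\<delta>)) / \<delta>"
      using Suc.IH unfolding sum.lessThan_Suc[of _ "Suc N"] y x_def[symmetric] by linarith
    also have "\<dots> = 1 + (1 - (x + 1) powr (-\<delta>)) / \<delta>" using \<delta> by (simp add: field_simps)
    finally show ?case unfolding y .
  qed simp
  show "(\<Sum>k. real (Suc k) powr (- (1 + \<delta>))) \<le> 1 + 1 / \<delta>"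
  proof (rule suminf_le_const[OF sm])
    fix N
    have "(\<Sum>k<N. real (Suc k) powr (- (1 + \<delta>))) \<le> (\<Sum>k<Suc N. real (Suc k) powr (- (1 + \<delta>)))" by simp
    also have "\<dots> \<le> 1 + (1 - real (Suc N) powr (-\<delta>)) / \<delta>" by (rule part)
    also have "\<dots> \<le> 1 + 1 / \<delta>" using \<delta> by (intro add_left_mono divide_right_mono) auto
    finally show "(\<Sum>k<N. real (Suc k) powr (- (1 + \<delta>))) \<le> 1 + 1 / \<delta>" .
  qed
qed

text \<open>Put \<open>s = 1 + \<delta>\<close>. A zero at \<open>s = 1\<close> gives \<open>\<bar>L(s, \<psi>)\<bar> \<le> K \<delta>\<close>, while \<open>\<zeta>(s) \<le> 1 + 1/\<delta>\<close> and
\<open>\<bar>L(s, \<psi>\<^sup>2)\<bar> \<le> B\<close>. The fourth power outweighs the pole of order three, so the product that is at least \<open>1\<close> by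
\<open>three_four_one\<close> is at most a constant times \<open>\<delta>\<close>. The hypothesis on the partial sums of \<open>\<psi>\<^sup>2\<close> is what
excludes real characters here.\<close>

lemma complex_char_series_nonzero:
  fixes \<psi> :: "nat \<Rightarrow> complex"
  assumes mult: "\<And>a b. \<psi> (a * b) = \<psi> a * \<psi> b" and \<psi>1: "\<psi> 1 = 1"
    and val: "\<And>a. norm (\<psi> a) = 0 \<or> norm (\<psi> a) = 1"
    and bnd: "\<And>N. norm (\<Sum>m<N. \<psi> (Suc m)) \<le> B"
    and bnd2: "\<And>N. norm (\<Sum>m<N. (\<psi> (Suc m))\<^sup>2) \<le> B"
  shows "\<not> (\<lambda>k. \<psi> (Suc k) / of_nat (Suc k)) sums 0"
proof
  assume zero: "(\<lambda>k. \<psi> (Suc k) / of_nat (Suc k)) sums 0"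
  define Z where "Z = (\<Sum>k. real (Suc k) powr (- (3 / 2)))"
  have sZ: "summable (\<lambda>k. real (Suc k) powr (- (3 / 2)))" using zeta_bound(1)[of "1 / 2"] by simp
  have B0: "B \<ge> 0" using bnd[of 0] by simp
  have Z0: "Z \<ge> 0" unfolding Z_def by (intro suminf_nonneg sZ) auto
  define K where "K = 2 * B * Z"
  have main: "1 \<le> 8 * K ^ 4 * B * \<delta>" if \<delta>: "0 < \<delta>" "\<delta> \<le> 1" for \<delta> :: real
  proof -
    define s where "s = 1 + \<delta>"
    define e where "e m = real m powr (- s)" for m :: nat
    have emult: "e (a * b) = e a * e b" for a b by (simp add: e_def powr_mult)
    have e1: "e (Suc 0) = 1" by (simp add: e_def)
    have e0: "e m \<ge> 0" for m by (simp add: e_def)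
    have es: "summable (\<lambda>k. e (Suc k))" using zeta_bound(1)[OF \<delta>(1)] by (simp add: e_def s_def)
    have edec: "decseq (\<lambda>k. e (Suc k))"
    proof (rule decseq_SucI)
      show "e (Suc (Suc k)) \<le> e (Suc k)" for k
        unfolding e_def using \<delta> by (intro powr_mono2') (auto simp: s_def)
    qed
    have elim: "(\<lambda>k. e (Suc k)) \<longlonglongrightarrow> 0" by (rule summable_LIMSEQ_zero[OF es])
    define \<zeta> where "\<zeta> = (\<Sum>k. e (Suc k))"
    have \<zeta>: "(\<lambda>k. e (Suc k)) sums \<zeta>" unfolding \<zeta>_def using es by (rule summable_sums)
    have \<zeta>b: "\<zeta> \<le> 1 + 1 / \<delta>" using zeta_bound(2)[OF \<delta>(1)] by (simp add: \<zeta>_def e_def s_def)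
    have \<zeta>0: "\<zeta> \<ge> 0" unfolding \<zeta>_def by (intro suminf_nonneg es e0)
    obtain L2 where L2: "(\<lambda>k. of_real (e (Suc k)) * (\<psi> (Suc k))\<^sup>2) sums L2" and L2b: "norm L2 \<le> B * e (Suc 0)"
      using sums_by_parts_decseq[OF bnd2 edec elim] by blast
    have L2b': "norm L2 \<le> B" using L2b e1 by simp
    \<comment> \<open>As \<open>L(1, \<psi>) = 0\<close>, the series of \<open>-L(s, \<psi>)\<close> has the weights \<open>1/m - 1/m^s\<close>, whose total
      variation is \<open>O(\<delta>)\<close>.\<close>
    define d where "d k = 1 / real (Suc k) - e (Suc k)" for k
    have dvar: "\<bar>d k - d (Suc k)\<bar> \<le> 2 * \<delta> * real (Suc k) powr (- (3 / 2))" for k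
    proof -
      define x where "x = real (Suc k)"
      have x: "x \<ge> 1" by (simp add: x_def)
      have y: "real (Suc (Suc k)) = x + 1" by (simp add: x_def)
      have ex: "y powr (- s) = y powr (-\<delta>) / y" if "y > 0" for y :: real
        using that powr_diff[of y "- \<delta>" 1] by (simp add: s_def minus_diff_commute)
      have eq: "d k - d (Suc k) = (1 - x powr (-\<delta>)) / (x * (x + 1)) - (x powr (-\<delta>) - (x + 1) powr (-\<delta>)) / (x + 1)"
      proof -
        have "d k - d (Suc k) = 1 / x - x powr (-\<delta>) / x - (1 / (x + 1) - (x + 1) powr (-\<delta>) / (x + 1))"
          unfolding d_def e_def y x_def[symmetric] using x ex[of x] ex[of "x + 1"] by simp
        also have "\<dots> = (1 - x powr (-\<delta>)) / (x * (x + 1)) - (x powr (-\<delta>) - (x + 1) powr (-\<delta>)) / (x + 1)"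
          using x by (simp add: divide_simps) (simp add: algebra_simps)
        finally show ?thesis .
      qed
      have xp: "x powr (-\<delta>) \<le> 1" using x \<delta> powr_mono[of "-\<delta>" 0 x] by simp
      have A: "0 \<le> 1 - x powr (-\<delta>)" "1 - x powr (-\<delta>) \<le> \<delta> * ln x"
        using xp powr_minus_diff(1)[of 1 x \<delta>] x \<delta> by auto
      have "ln ((x + 1) / x) \<le> (x + 1) / x - 1" using x by (intro ln_le_minus_one) auto
      then have ln1: "ln (x + 1) - ln x \<le> 1 / x" using x by (simp add: ln_div field_simps)
      have "x powr (-\<delta>) - (x + 1) powr (-\<delta>) \<le> x powr (-\<delta>) * (\<delta> * (ln (x + 1) - ln x))"
        by (rule powr_minus_diff(1)) (use x \<delta> in auto)
      also have "\<dots> \<le> 1 * (\<delta> * (1 / x))"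
        using xp ln1 x \<delta> by (intro mult_mono) auto
      finally have D: "x powr (-\<delta>) - (x + 1) powr (-\<delta>) \<le> \<delta> / x" by simp
      have D0: "0 \<le> x powr (-\<delta>) - (x + 1) powr (-\<delta>)"
        using x \<delta> by (simp add: powr_mono2')
      have "\<bar>d k - d (Suc k)\<bar> \<le> (1 - x powr (-\<delta>)) / (x * (x + 1)) + (x powr (-\<delta>) - (x + 1) powr (-\<delta>)) / (x + 1)"
        unfolding eq using A(1) D0 x by (intro order.trans[OF abs_triangle_ineq4]) simp
      also have "\<dots> \<le> (\<delta> * ln x) / (x * (x + 1)) + (\<delta> / x) / (x + 1)"
        using A(2) D x by (intro add_mono divide_right_mono) auto
      also have "\<dots> = \<delta> * (1 + ln x) / (x * (x + 1))" using x by (simp add: add_divide_distrib distrib_left add.commute)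
      also have "\<dots> \<le> \<delta> * (2 * sqrt x) / (x * x)"
      proof (rule frac_le)
        \<comment> \<open>Trading the logarithm for a square root leaves the summable exponent \<open>3/2\<close>.\<close>
        have "ln (sqrt x) \<le> sqrt x - 1" using x by (intro ln_le_minus_one) auto
        then have "1 + ln x \<le> 2 * sqrt x" using x by (simp add: ln_sqrt)
        then show "\<delta> * (1 + ln x) \<le> \<delta> * (2 * sqrt x)" using \<delta> by (intro mult_left_mono) auto
      qed (use x \<delta> in auto)
      also have "\<dots> = 2 * \<delta> * x powr (- (3 / 2))"
      proof -
        have "x powr (- (3 / 2)) * (x * x) = x powr (- (3 / 2)) * x powr 2" using x by (simp add: power2_eq_square)
        also have "\<dots> = x powr (- (3 / 2) + 2)" by (simp only: powr_add)
        also have "\<dots> = sqrt x" using x by (simp add: powr_half_sqrt)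
        finally show ?thesis using x by (simp add: field_simps)
      qed
      finally show ?thesis unfolding x_def .
    qed
    have sd': "summable (\<lambda>k. 2 * \<delta> * real (Suc k) powr (- (3 / 2)))" by (rule summable_mult[OF sZ])
    have sd: "summable (\<lambda>k. \<bar>d k - d (Suc k)\<bar>)"
      by (rule summable_comparison_test'[OF sd', of 0]) (use dvar in auto)
    have dlim: "d \<longlonglongrightarrow> 0"
      using tendsto_diff[OF LIMSEQ_inverse_real_of_nat elim] by (simp add: d_def[abs_def] inverse_eq_divide)
    obtain S where S: "(\<lambda>k. of_real (d k) * \<psi> (Suc k)) sums S" and Sb: "norm S \<le> B * (\<Sum>k. \<bar>d k - d (Suc k)\<bar>)"
      using sums_by_parts[OF bnd sd dlim] by blast
    have "(\<Sum>k. \<bar>d k - d (Suc k)\<bar>) \<le> (\<Sum>k. 2 * \<delta> * real (Suc k) powr (- (3 / 2)))"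
      by (rule suminf_le[OF dvar sd sd'])
    also have "\<dots> = 2 * \<delta> * Z" unfolding Z_def by (rule suminf_mult[OF sZ])
    finally have "norm S \<le> B * (2 * \<delta> * Z)"
      using Sb B0 mult_left_mono order.trans by blast
    then have Sb': "norm S \<le> K * \<delta>" by (simp add: K_def mult_ac)
    have "(\<lambda>k. \<psi> (Suc k) / of_nat (Suc k) - of_real (d k) * \<psi> (Suc k)) sums (0 - S)"
      by (rule sums_diff[OF zero S])
    moreover have "\<psi> (Suc k) / of_nat (Suc k) - of_real (d k) * \<psi> (Suc k) = of_real (e (Suc k)) * \<psi> (Suc k)" for k
      by (simp add: d_def algebra_simps del: of_nat_Suc)
    ultimately have L: "(\<lambda>k. of_real (e (Suc k)) * \<psi> (Suc k)) sums (- S)" by simp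
    have nle: "norm (\<psi> m) \<le> 1" for m using val[of m] by auto
    have s1: "summable (\<lambda>k. norm (complex_of_real (e (Suc k))))" using es e0 by simp
    have s2: "summable (\<lambda>k. norm (of_real (e (Suc k)) * \<psi> (Suc k)))"
      by (rule summable_comparison_test'[OF es, of 0]) (use e0 nle in \<open>auto simp: norm_mult intro: mult_left_le\<close>)
    have s3: "summable (\<lambda>k. norm (of_real (e (Suc k)) * (\<psi> (Suc k))\<^sup>2))"
      by (rule summable_comparison_test'[OF es, of 0])
         (use e0 nle in \<open>auto simp: norm_mult norm_power intro!: mult_left_le power_le_one\<close>)
    let ?P = "\<lambda>N. {p::nat. prime p \<and> p \<le> N}"
    define E1 where "E1 N = (\<Prod>p\<in>?P N. 1 - complex_of_real (e p))" for N
    define E2 where "E2 N = (\<Prod>p\<in>?P N. 1 - of_real (e p) * \<psi> p)" for N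
    define E3 where "E3 N = (\<Prod>p\<in>?P N. 1 - of_real (e p) * (\<psi> p)\<^sup>2)" for N
    have t1: "(\<lambda>N. of_real \<zeta> * E1 N) \<longlonglongrightarrow> 1"
      unfolding E1_def by (rule euler_product_tendsto[OF _ _ s1 sums_of_real[OF \<zeta>]]) (auto simp: emult e1)
    have t2: "(\<lambda>N. - S * E2 N) \<longlonglongrightarrow> 1"
      unfolding E2_def using e1 \<psi>1[unfolded One_nat_def] by (intro euler_product_tendsto[OF _ _ s2 L]) (auto simp: emult mult)
    have t3: "(\<lambda>N. L2 * E3 N) \<longlonglongrightarrow> 1"
      unfolding E3_def using e1 \<psi>1[unfolded One_nat_def]
      by (intro euler_product_tendsto[OF _ _ s3 L2]) (auto simp: emult mult power_mult_distrib)
    have lim: "(\<lambda>N. norm (of_real \<zeta> * E1 N) ^ 3 * norm (- S * E2 N) ^ 4 * norm (L2 * E3 N)) \<longlonglongrightarrow> norm (1::complex) ^ 3 * norm (1::complex) ^ 4 * norm (1::complex)"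
      by (intro tendsto_intros t1 t2 t3)
    have le: "norm (of_real \<zeta> * E1 N) ^ 3 * norm (- S * E2 N) ^ 4 * norm (L2 * E3 N) \<le> \<zeta> ^ 3 * norm S ^ 4 * norm L2" for N
    proof -
      have "norm (E1 N) ^ 3 * norm (E2 N) ^ 4 * norm (E3 N)
        = (\<Prod>p\<in>?P N. norm (1 - complex_of_real (e p)) ^ 3 * norm (1 - of_real (e p) * \<psi> p) ^ 4 * norm (1 - of_real (e p) * (\<psi> p)\<^sup>2))"
        unfolding E1_def E2_def E3_def by (simp add: prod.distrib prod_norm[symmetric] prod_power_distrib)
      also have "\<dots> \<le> 1"
      proof (rule prod_le_1, intro conjI)
        fix p assume "p \<in> ?P N"
        then have p: "p \<ge> 2" using prime_ge_2_nat by auto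
        have ep: "0 < e p" using p by (simp add: e_def)
        have "e p < real p powr 0" unfolding e_def using p \<delta> by (intro powr_less_mono) (auto simp: s_def)
        then have ep1: "e p < 1" using p by simp
        have "norm (1 - complex_of_real (e p)) = 1 - e p"
          using ep1 norm_of_real[of "1 - e p", where 'a = complex] by simp
        then show "norm (1 - complex_of_real (e p)) ^ 3 * norm (1 - of_real (e p) * \<psi> p) ^ 4 * norm (1 - of_real (e p) * (\<psi> p)\<^sup>2) \<le> 1"
          using three_four_one[OF ep ep1 val[of p]] by simp
      qed auto
      finally have E: "norm (E1 N) ^ 3 * norm (E2 N) ^ 4 * norm (E3 N) \<le> 1" .
      have "norm (of_real \<zeta> * E1 N) ^ 3 * norm (- S * E2 N) ^ 4 * norm (L2 * E3 N)
        = (\<zeta> ^ 3 * norm S ^ 4 * norm L2) * (norm (E1 N) ^ 3 * norm (E2 N) ^ 4 * norm (E3 N))"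
        using \<zeta>0 by (simp add: norm_mult power_mult_distrib)
      also have "\<dots> \<le> (\<zeta> ^ 3 * norm S ^ 4 * norm L2) * 1"
        by (rule mult_left_mono[OF E]) (use \<zeta>0 in auto)
      finally show ?thesis by simp
    qed
    have "1 \<le> \<zeta> ^ 3 * norm S ^ 4 * norm L2"
      using LIMSEQ_le_const2[OF lim] le by auto
    also have "\<dots> \<le> (1 + 1 / \<delta>) ^ 3 * (K * \<delta>) ^ 4 * B"
      using \<zeta>0 \<zeta>b Sb' L2b' \<delta> B0 Z0 by (intro mult_mono power_mono) (auto simp: K_def)
    also have "\<dots> = (\<delta> + 1) ^ 3 * (K ^ 4 * B * \<delta>)"
    proof -
      have "(1 + 1 / \<delta>) ^ 3 * \<delta> ^ 3 = (\<delta> + 1) ^ 3"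
        using \<delta> by (simp add: field_simps flip: power_mult_distrib)
      moreover have "(1 + 1 / \<delta>) ^ 3 * (K * \<delta>) ^ 4 * B = ((1 + 1 / \<delta>) ^ 3 * \<delta> ^ 3) * (K ^ 4 * B * \<delta>)"
        by (simp add: power_mult_distrib power4_eq_xxxx power3_eq_cube)
      ultimately show ?thesis by (simp only:)
    qed
    also have "\<dots> \<le> 2 ^ 3 * (K ^ 4 * B * \<delta>)"
      using \<delta> B0 by (intro mult_right_mono power_mono) auto
    finally show ?thesis by simp
  qed
  define Q where "Q = 8 * K ^ 4 * B"
  have Q0: "Q \<ge> 0" using B0 by (simp add: Q_def)
  then have "0 < 1 / (Q + 1)" "1 / (Q + 1) \<le> 1" by auto
  from main[OF this] have "1 \<le> Q * (1 / (Q + 1))" by (simp only: Q_def)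
  then show False using Q0 by (simp add: field_simps)
qed

section \<open>Odd characters and the odd part of the multiplication table\<close>

text \<open>If some unit \<open>c\<close> has \<open>(\<psi> c)\<^sup>2 \<noteq> 1\<close>, then multiplication by \<open>c\<close> shows that \<open>\<psi>\<^sup>2\<close> sums to zero over a
period, and the complex case applies; otherwise \<open>\<psi>\<close> has values in \<open>{-1, 0, 1}\<close>.\<close>

lemma odd_char_series_nonzero:
  assumes n: "n > 0" and char: "dirichlet_char n \<psi>" and odd: "\<psi> (- 1) = - 1"
  shows "\<not> (\<lambda>k. \<psi> (int (Suc k)) / of_nat (Suc k)) sums 0"
proof -
  have per: "\<psi> (x + int n) = \<psi> x" and mult: "\<psi> (x * y) = \<psi> x * \<psi> y" and one: "\<psi> 1 = 1"
    and supp: "\<psi> x = 0 \<longleftrightarrow> \<not> coprime x (int n)" for x y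
    using char by (auto simp: dirichlet_char_def)
  have oddx: "\<psi> (- x) = - \<psi> x" for x using mult[of "-1" x] odd by simp
  have pow: "\<psi> (x ^ k) = \<psi> x ^ k" for x k using one by (induction k) (auto simp: mult)
  have val: "norm (\<psi> x) = 0 \<or> norm (\<psi> x) = 1" for x
  proof (cases "coprime x (int n)")
    case True
    define c where "c = nat (x mod int n)"
    have c: "int c = x mod int n" using n by (simp add: c_def)
    have "coprime (int c) (int n)" using True n by (simp add: c coprime_mod_left_iff)
    then have "[c ^ totient n = 1] (mod n)" by (intro euler_theorem) simp
    then have "[int c ^ totient n = 1] (mod int n)" by (metis cong_int_iff of_nat_1 of_nat_power)
    then have "\<psi> (int c ^ totient n) = \<psi> 1" by (rule periodic_cong[of \<psi> n, OF per])
    then have "\<psi> x ^ totient n = 1"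
      using periodic_mod[of \<psi> n x, OF per] by (simp add: pow c one)
    from power_eq_1_iff[OF this] show ?thesis using n by auto
  qed (use supp in auto)
  have le1: "norm (\<psi> x) \<le> 1" for x using val[of x] by auto
  have sum0: "(\<Sum>b<n. \<psi> (int b)) = 0" by (rule sum_odd_residues[OF n]) (auto simp: per oddx)
  have bnd: "norm (\<Sum>m<N. \<psi> (int (Suc m))) \<le> real n" for N
    by (rule periodic_partial_sums_bounded[of "\<lambda>m. \<psi> (int m)"]) (use per sum0 le1 n in auto)
  show ?thesis
  proof (cases "\<exists>c. coprime c (int n) \<and> (\<psi> c)\<^sup>2 \<noteq> 1")
    case True
    then obtain c where c: "coprime c (int n)" "(\<psi> c)\<^sup>2 \<noteq> 1" by blast
    have "(\<Sum>b<n. (\<psi> (c * int b))\<^sup>2) = (\<Sum>b<n. (\<psi> (int b))\<^sup>2)"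
      using sum_residues_mult[of n "\<lambda>x. (\<psi> x)\<^sup>2" c] n c(1) per by simp
    then have "(\<psi> c)\<^sup>2 * (\<Sum>b<n. (\<psi> (int b))\<^sup>2) = (\<Sum>b<n. (\<psi> (int b))\<^sup>2)"
      by (simp add: mult power_mult_distrib sum_distrib_left)
    then have sum0': "(\<Sum>b<n. (\<psi> (int b))\<^sup>2) = 0" using c(2) by simp
    have bnd2: "norm (\<Sum>m<N. (\<psi> (int (Suc m)))\<^sup>2) \<le> real n" for N
      by (rule periodic_partial_sums_bounded[of "\<lambda>m. (\<psi> (int m))\<^sup>2"])
         (use per sum0' le1 n in \<open>auto simp: norm_power intro: power_le_one\<close>)
    show ?thesis
      by (rule complex_char_series_nonzero[of "\<lambda>m. \<psi> (int m)", OF _ _ val bnd bnd2]) (auto simp: mult one)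
  next
    case False
    define c where "c m = Re (\<psi> (int m))" for m :: nat
    have v: "\<psi> (int m) = of_real (c m) \<and> c m \<in> {-1, 0, 1}" for m
    proof (cases "coprime (int m) (int n)")
      case True
      then have "(\<psi> (int m))\<^sup>2 = 1" using False by blast
      then have "\<psi> (int m) = 1 \<or> \<psi> (int m) = - 1" by (simp add: power2_eq_1_iff)
      then show ?thesis by (auto simp: c_def)
    next
      case False
      then have "\<psi> (int m) = 0" using supp by blast
      then show ?thesis by (simp add: c_def)
    qed
    have cb: "\<bar>\<Sum>m<N. c (Suc m)\<bar> \<le> real n" for N
    proof -
      have "(\<Sum>m<N. \<psi> (int (Suc m))) = of_real (\<Sum>m<N. c (Suc m))"
        unfolding of_real_sum by (intro sum.cong refl) (use v in blast)
      then show ?thesis using bnd[of N] by (simp only: norm_of_real)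
    qed
    have cm: "c (a * b) = c a * c b" for a b
    proof -
      have "complex_of_real (c (a * b)) = of_real (c a * c b)"
        unfolding of_real_mult using v mult[of "int a" "int b"] by (metis of_nat_mult)
      then show ?thesis by (simp only: of_real_eq_iff)
    qed
    have c1: "c 1 = 1" by (simp add: c_def one)
    have "\<not> (\<lambda>k. c (Suc k) / real (Suc k)) sums 0"
      by (rule real_char_series_nonzero[OF cm c1 _ cb]) (use v in blast)
    moreover have "Re (\<psi> (int (Suc k)) / of_nat (Suc k)) = c (Suc k) / real (Suc k)" for k
      by (simp only: c_def Re_divide_of_nat)
    ultimately show ?thesis using sums_Re[of "\<lambda>k. \<psi> (int (Suc k)) / of_nat (Suc k)" 0] by auto
  qed
qed

text \<open>This is where the analytic part ends: the odd part of the multiplication table is injective on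
odd functions.\<close>

theorem odd_sawtooth_kernel_trivial:
  fixes f :: "int \<Rightarrow> complex"
  assumes n: "n > 0" and per: "\<And>x. f (x + int n) = f x" and odd: "\<And>x. f (- x) = - f x"
    and ker: "\<And>a::int. (\<Sum>b<n. f (int b) * of_int (a * int b mod int n)) = 0"
  shows "f x = 0"
proof -
  define g where "g = residue_dft n f"
  have g0: "g m = 0" for m
  proof (rule ccontr)
    assume m: "g m \<noteq> 0"
    have "(\<lambda>x. if coprime x (int n) then g (m * x) else 0) \<in> odd_null_space n"
      by (rule coprime_part_in_odd_null_space[OF n])
         (use n per odd ker in \<open>auto simp: g_def residue_dft_periodic residue_dft_odd
            intro!: sawtooth_kernel_imp_dft_sums_zero simp del: of_nat_Suc\<close>)
    then show False
      using odd_null_space_imp_char[OF n, of _ 1] odd_char_series_nonzero[OF n] m by force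
  qed
  have "f (int b) = 0" if "b < n" for b
  proof (rule dft_injective[OF n _ that])
    fix j assume "j < n"
    show "(\<Sum>k<n. f (int k) * cis (2 * pi * real j * real k / real n)) = 0"
      using g0[of "int j"] by (simp add: g_def residue_dft_def mult.assoc)
  qed
  from this[of "nat (x mod int n)"] show ?thesis
    using n periodic_mod[of f n x, OF per] by (simp add: nat_less_iff)
qed

section \<open>Rank and independent families\<close>

text \<open>The family \<open>w\<close> is a basis of the column space, given by coordinates. Indexing it by an arbitrary
finite set allows a disjoint sum as index set, which is how the odd and the even part are combined.\<close>

lemma rank_eq_card_independent_family:
  fixes A :: "real Matrix.mat" and w :: "'i \<Rightarrow> nat \<Rightarrow> real"
  assumes A: "A \<in> carrier_mat m nc" and I: "finite I"
    and spans: "\<And>j. j < nc \<Longrightarrow> \<exists>x. \<forall>a<m. A $$ (a, j) = (\<Sum>i\<in>I. x i * w i a)"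
    and spanned: "\<And>i. i \<in> I \<Longrightarrow> \<exists>y. \<forall>a<m. w i a = (\<Sum>j<nc. y j * A $$ (a, j))"
    and indep: "\<And>x i. (\<And>a. a < m \<Longrightarrow> (\<Sum>i\<in>I. x i * w i a) = 0) \<Longrightarrow> i \<in> I \<Longrightarrow> x i = 0"
  shows "vec_space.rank m A = card I"
proof -
  interpret vs: vec_space "TYPE(real)" m .
  define N where "N = card I"
  obtain e where e: "bij_betw e {..<N} I"
    using ex_bij_betw_nat_finite[OF I] unfolding N_def atLeast0LessThan by blast
  define W where "W = Matrix.mat m N (\<lambda>(a, i). w (e i) a)"
  have W: "W \<in> carrier_mat m N" by (simp add: W_def)
  have mult: "(B *\<^sub>v x) $ a = (\<Sum>j<k. x $ j * B $$ (a, j))"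
    if "B \<in> carrier_mat m k" "x \<in> carrier_vec k" "a < m" for B :: "real Matrix.mat" and x k a
    using that by (auto simp: scalar_prod_def atLeast0LessThan intro!: sum.cong)
  have WI: "(\<Sum>i<N. x i * W $$ (a, i)) = (\<Sum>i\<in>I. x (inv_into {..<N} e i) * w i a)" if "a < m" for x a
  proof -
    have "(\<Sum>i\<in>I. x (inv_into {..<N} e i) * w i a) = (\<Sum>i<N. x (inv_into {..<N} e (e i)) * w (e i) a)"
      by (rule sum.reindex_bij_betw[OF e, symmetric])
    also have "\<dots> = (\<Sum>i<N. x i * W $$ (a, i))"
      using that bij_betw_inv_into_left[OF e] by (intro sum.cong) (auto simp: W_def)
    finally show ?thesis ..
  qed
  have cols_in: "Matrix.col B j \<in> vs.col_space A'"
    if B: "B \<in> carrier_mat m k" and A': "A' \<in> carrier_mat m k'"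
      and ex: "\<exists>y. \<forall>a<m. B $$ (a, j) = (\<Sum>i<k'. y i * A' $$ (a, i))" and j: "j < k"
    for B A' :: "real Matrix.mat" and j k k'
  proof -
    from ex obtain y where y: "\<And>a. a < m \<Longrightarrow> B $$ (a, j) = (\<Sum>i<k'. y i * A' $$ (a, i))" by blast
    have "A' *\<^sub>v Matrix.vec k' y = Matrix.col B j"
      using B A' j y by (intro eq_vecI) (auto simp: mult[OF A'] simp del: index_mult_mat_vec)
    then show ?thesis
      unfolding vs.col_space_eq[OF A'] using A' B j by (auto intro!: bexI[of _ "Matrix.vec k' y"])
  qed
  have "set (cols A) \<subseteq> vs.col_space W"
  proof
    fix v assume "v \<in> set (cols A)"
    then obtain j where j: "j < nc" "v = Matrix.col A j" using A by (auto simp: cols_def)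
    obtain x where x: "\<And>a. a < m \<Longrightarrow> A $$ (a, j) = (\<Sum>i\<in>I. x i * w i a)" using spans[OF j(1)] by blast
    have "A $$ (a, j) = (\<Sum>i<N. x (e i) * W $$ (a, i))" if "a < m" for a
      unfolding WI[OF that, of "\<lambda>i. x (e i)"] x[OF that]
      using bij_betw_inv_into_right[OF e] by (intro sum.cong) auto
    then show "v \<in> vs.col_space W" 
      unfolding j(2) by (intro cols_in[OF A W _ j(1)] exI[of _ "\<lambda>i. x (e i)"] allI impI)
  qed
  moreover have "set (cols W) \<subseteq> vs.col_space A"
  proof
    fix v assume "v \<in> set (cols W)"
    then obtain i where i: "i < N" "v = Matrix.col W i" using W by (auto simp: cols_def)
    then have "e i \<in> I" using e by (auto simp: bij_betw_def)
    from spanned[OF this] obtain y where "\<forall>a<m. w (e i) a = (\<Sum>j<nc. y j * A $$ (a, j))" by blast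
    then have "\<forall>a<m. W $$ (a, i) = (\<Sum>j<nc. y j * A $$ (a, j))" using i by (simp add: W_def)
    then show "v \<in> vs.col_space A" 
      unfolding i(2) by (intro cols_in[OF W A _ i(1)] exI[of _ y])
  qed
  moreover have cA: "set (cols A) \<subseteq> carrier_vec m" and cW: "set (cols W) \<subseteq> carrier_vec m"
    using A W cols_dim by blast+
  ultimately have "vs.span (set (cols A)) = vs.span (set (cols W))"
    unfolding vs.col_space_def
    by (metis subset_antisym vs.span_is_submodule vs.span_is_subset)
  then have rank_eq: "vs.rank A = vs.rank W" unfolding vs.rank_def by simp
  have ker: "v = 0\<^sub>v N" if v: "v \<in> carrier_vec N" and Wv: "W *\<^sub>v v = 0\<^sub>v m" for v
  proof (rule eq_vecI)
    fix i assume i: "i < dim_vec (0\<^sub>v N)"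
    have "(\<Sum>i\<in>I. v $ (inv_into {..<N} e i) * w i a) = 0" if "a < m" for a
      using mult[OF W v that] Wv that by (simp only: WI[OF that] index_zero_vec)
    moreover have "e i \<in> I" using i e by (auto simp: bij_betw_def)
    ultimately have "v $ (inv_into {..<N} e (e i)) = 0" by (rule indep)
    moreover have "inv_into {..<N} e (e i) = i"
      using i by (intro bij_betw_inv_into_left[OF e]) simp
    ultimately show "v $ i = 0\<^sub>v N $ i" using i by simp
  qed (use v in auto)
  have "distinct (cols W)"
  proof (rule ccontr)
    assume "\<not> distinct (cols W)"
    then obtain i j where ij: "i < N" "j < N" "i \<noteq> j" "Matrix.col W i = Matrix.col W j"
      using W by (auto simp: distinct_conv_nth)
    define v where "v = (unit_vec N i :: real Matrix.vec) - unit_vec N j"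
    have "W *\<^sub>v v = 0\<^sub>v m"
    proof (rule eq_vecI)
      fix a assume "a < dim_vec (0\<^sub>v m)"
      then have a: "a < m" by simp
      have "(W *\<^sub>v v) $ a = (\<Sum>k<N. v $ k * W $$ (a, k))"
        by (rule mult[OF W _ a]) (simp add: v_def)
      also have "\<dots> = (\<Sum>k<N. (if k = i then W $$ (a, i) else 0) - (if k = j then W $$ (a, j) else 0))"
        using ij by (intro sum.cong) (auto simp: v_def)
      also have "\<dots> = W $$ (a, i) - W $$ (a, j)" using ij by (simp add: sum_subtractf)
      also have "\<dots> = 0"
        using arg_cong[OF ij(4), of "\<lambda>v. v $ a"] ij(1,2) W a by simp
      finally show "(W *\<^sub>v v) $ a = 0\<^sub>v m $ a" using a by simp
    qed (use W in simp)
    then have "v = 0\<^sub>v N" by (intro ker) (auto simp: v_def)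
    then have "v $ i = 0" using ij by simp
    then show False using ij by (simp add: v_def unit_vec_def)
  qed
  moreover have "vs.lin_indpt (set (cols W))"
    using vs.lin_depE[OF W _ \<open>distinct (cols W)\<close>] ker by metis
  ultimately have "vs.rank W = N" by (rule vs.lin_indpt_full_rank[OF W])
  then show ?thesis using rank_eq by (simp add: N_def)
qed


section \<open>The rank of the multiplication table modulo n\<close>

lemma residue_add_residue_minus:
  fixes y :: int
  assumes "n > 0"
  shows "y mod int n + (- y) mod int n = (if int n dvd y then 0 else int n)"
  using assms by (auto simp: zmod_zminus1_eq_if)

text \<open>The even part of the table depends on a column index only through its gcd with \<open>n\<close>.\<close>

lemma dvd_mult_gcd_iff:
  fixes x b n :: int
  shows "n dvd x * gcd b n \<longleftrightarrow> n dvd x * b"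
proof
  assume "n dvd x * b"
  then have "n dvd gcd (x * b) (x * n)" by simp
  also have "gcd (x * b) (x * n) = \<bar>x * gcd b n\<bar>" by (simp add: gcd_mult_left abs_mult)
  finally show "n dvd x * gcd b n" by (simp only: dvd_abs_iff)
next
  assume "n dvd x * gcd b n"
  moreover have "x * gcd b n dvd x * b" by simp
  ultimately show "n dvd x * b" by (rule dvd_trans)
qed

text \<open>Taking \<open>x = 1\<close> shows that the sum of all \<open>v f\<close> is zero, so the relation may be complemented: the
sum of \<open>v f\<close> over those \<open>f\<close> for which \<open>n dvd x f\<close> is zero. For \<open>x = n div f0\<close> these are the multiples of \<open>f0\<close>, which
gives a triangular system to be solved from the largest \<open>f\<close> downwards.\<close>

lemma divisor_indicators_independent:
  fixes v :: "nat \<Rightarrow> real"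
  assumes n: "n > 0" and zero: "\<And>x. 1 \<le> x \<Longrightarrow> x < n \<Longrightarrow> (\<Sum>f | f dvd n \<and> f < n. if n dvd x * f then 0 else v f) = 0"
    and f: "f dvd n" "f < n"
  shows "v f = 0"
  using f
proof (induction "n - f" arbitrary: f rule: less_induct)
  case less
  let ?D = "{f. f dvd n \<and> f < n}"
  have fin: "finite ?D" by simp
  have "f > 0" using less.prems n by (auto intro: Nat.gr0I)
  \<comment> \<open>At \<open>x = n\<close> every term is zero. This value is needed for \<open>f = 1\<close>.\<close>
  have all: "(\<Sum>f\<in>?D. if n dvd x * f then 0 else v f) = 0" if "1 \<le> x" "x \<le> n" for x
    using zero[of x] that by (cases "x = n") auto
  have nd: "\<not> n dvd 1 * g" if "g \<in> ?D" for g
    using that n by (auto dest: dvd_imp_le simp: dvd_def)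
  have "(\<Sum>g\<in>?D. v g) = (\<Sum>g\<in>?D. if n dvd 1 * g then 0 else v g)"
    by (intro sum.cong refl) (use nd in simp)
  then have total: "(\<Sum>g\<in>?D. v g) = 0" using all[of 1] n by simp
  define x where "x = n div f"
  have x: "x * f = n" using less.prems by (simp add: x_def)
  have "1 \<le> x" "x \<le> n" using x n \<open>f > 0\<close> by (auto intro: Nat.gr0I simp: x_def Suc_le_eq)
  from all[OF this] have "(\<Sum>g\<in>?D. v g) - (\<Sum>g\<in>?D. if n dvd x * g then 0 else v g) = 0"
    using total by simp
  then have "(\<Sum>g\<in>?D. if n dvd x * g then v g else 0) = 0"
    unfolding sum_subtractf[symmetric] by (rule back_subst[of "\<lambda>s. s = 0"]) (intro sum.cong refl, simp)
  moreover have sel: "(if n dvd x * g then v g else 0) = (if g = f then v f else 0)" if g: "g \<in> ?D" for g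
  proof -
    have iff: "n dvd x * g \<longleftrightarrow> f dvd g"
    proof -
      have "x * f dvd x * g \<longleftrightarrow> f dvd g" using \<open>1 \<le> x\<close> by simp
      then show ?thesis by (simp only: x)
    qed
    show ?thesis
    proof (cases "f dvd g \<and> g \<noteq> f")
      case True
      then have "f < g" using g n by (metis dvd_imp_le dvd_pos_nat le_neq_implies_less mem_Collect_eq)
      then have "v g = 0" using less.hyps[of g] g by auto
      then show ?thesis using True by simp
    qed (use iff in auto)
  qed
  moreover have "(\<Sum>g\<in>?D. if n dvd x * g then v g else 0) = (\<Sum>g\<in>?D. if g = f then v f else 0)"
    by (intro sum.cong refl sel)
  ultimately have "(\<Sum>g\<in>?D. if g = f then v f else 0) = 0" by simp
  then show ?case using less.prems fin by (simp add: sum.delta)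
qed


text \<open>The basis of the column space consists of the odd parts \<open>s b\<close> of the columns \<open>1 \<le> b \<le> (n - 1) div 2\<close>
and of the even parts \<open>t f\<close> of the columns at the proper divisors \<open>f\<close> of \<open>n\<close>.\<close>

lemma rank_multiplication_table:
  assumes n: "n > 0" and m: "m = n \<or> m = n - 1"
  shows "vec_space.rank m (Matrix.mat m m (\<lambda>(i, j). real (((i + 1) * (j + 1)) mod n)))
    = (n - 1) div 2 + card {f. f dvd n \<and> f < n}"
proof -
  define A where "A = Matrix.mat m m (\<lambda>(i, j). real (((i + 1) * (j + 1)) mod n))"
  define R where "R y = real_of_int (y mod int n)" for y
  define r where "r = (n - 1) div 2"
  define D where "D = {f. f dvd n \<and> f < n}"
  define I where "I = {1..r} <+> D"
  define s where "s b x = R (x * int b) - R (- (x * int b))" for b x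
  define t :: "nat \<Rightarrow> int \<Rightarrow> real" where "t f x = (if int n dvd x * int f then 0 else 1)" for f x
  define w where "w = case_sum (\<lambda>b a. s b (int (Suc a))) (\<lambda>f a. t f (int (Suc a)))"
  have A: "A \<in> carrier_mat m m" by (simp add: A_def)
  have entry: "A $$ (a, j) = R (int (Suc a) * int (Suc j))" if "a < m" "j < m" for a j
  proof -
    have "int (Suc a) * int (Suc j) mod int n = int ((Suc a * Suc j) mod n)"
      by (simp only: zmod_int of_nat_mult)
    then show ?thesis using that by (simp add: A_def R_def del: of_nat_Suc mult_Suc mult_Suc_right)
  qed
  have R_cong: "R y = R z" if "int n dvd y - z" for y z
    using that by (simp add: R_def mod_eq_dvd_iff)
  have R_sum: "R y + R (- y) = real n * (if int n dvd y then 0 else 1)" for y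
    using arg_cong[OF residue_add_residue_minus[OF n, of y], of real_of_int] by (simp add: R_def)
  have R_half: "R y = (R y - R (- y)) / 2 + real n / 2 * (if int n dvd y then 0 else 1)" for y
    using R_sum[of y] by (simp add: field_simps)
  have reflect: "R (x * int (n - b)) = R (- (x * int b))" "R (- (x * int (n - b))) = R (x * int b)" if "b \<le> n" for x b
    using that by (auto intro!: R_cong simp: of_nat_diff algebra_simps)
  have finD: "finite D" and D0: "\<And>f. f \<in> D \<Longrightarrow> 0 < f \<and> f < n"
    using n by (auto simp: D_def intro: Nat.gr0I)
  have sumI: "(\<Sum>i\<in>I. g i) = (\<Sum>b=1..r. g (Inl b)) + (\<Sum>f\<in>D. g (Inr f))" for g :: "nat + nat \<Rightarrow> real"
    unfolding I_def using finD by (subst sum.Plus) auto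
  have r: "b \<le> r \<longleftrightarrow> 2 * b < n" for b using n by (auto simp: r_def)
  have pick: "(\<Sum>j<m. (if j = p - 1 then 1 else 0) * A $$ (a, j)) = R (int (Suc a) * int p)"
    if "a < m" "0 < p" "p < n" for a p
  proof -
    have "p - 1 < m" using that m by auto
    moreover have "(\<Sum>j<m. (if j = p - 1 then 1 else 0) * A $$ (a, j))
        = (\<Sum>j<m. if j = p - 1 then A $$ (a, p - 1) else 0)"
      by (intro sum.cong) auto
    ultimately show ?thesis using that entry[of a "p - 1"] by (simp del: of_nat_Suc)
  qed
  have pick_refl: "(\<Sum>j<m. (if j = (n - p) - 1 then 1 else 0) * A $$ (a, j)) = R (- (int (Suc a) * int p))"
    if "a < m" "0 < p" "p < n" for a p
    using pick[OF that(1), of "n - p"] reflect(1)[of p "int (Suc a)"] that by (simp only: diff_less zero_less_diff less_imp_le)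
  have "vec_space.rank m A = card I"
  proof (rule rank_eq_card_independent_family[OF A, where w = w])
    show "finite I" using finD by (simp add: I_def)
  next
    fix j assume j: "j < m"
    define b where "b = Suc j"
    have b: "0 < b" "b \<le> n" using j m by (auto simp: b_def)
    define g where "g = gcd b n"
    \<comment> \<open>At most one of \<open>b\<close> and \<open>n - b\<close> lies in \<open>{1..r}\<close>. If neither does, then \<open>2 b\<close> is a multiple of \<open>n\<close>, and
      the odd part of column \<open>b\<close> is zero.\<close>
    define xs :: "nat \<Rightarrow> real" where "xs k = (if k = b then 1 / 2 else if k = n - b then - 1 / 2 else 0)" for k
    define xt :: "nat \<Rightarrow> real" where "xt f = (if f = g then real n / 2 else 0)" for f
    have odd_part: "(\<Sum>k=1..r. xs k * s k x) = (R (x * int b) - R (- (x * int b))) / 2" for x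
    proof -
      consider "b \<le> r" | "0 < n - b \<and> n - b \<le> r" | "\<not> b \<le> r" "\<not> (0 < n - b \<and> n - b \<le> r)" by blast
      then show ?thesis
      proof cases
        case 1
        have "(\<Sum>k=1..r. xs k * s k x) = (\<Sum>k=1..r. if k = b then s b x / 2 else 0)"
          using 1 r by (intro sum.cong) (auto simp: xs_def)
        then show ?thesis using 1 b by (simp add: s_def)
      next
        case 2
        have "(\<Sum>k=1..r. xs k * s k x) = (\<Sum>k=1..r. if k = n - b then - s (n - b) x / 2 else 0)"
          using 2 r by (intro sum.cong) (auto simp: xs_def)
        also have "\<dots> = - s (n - b) x / 2" using 2 by (subst sum.delta) auto
        finally show ?thesis using reflect[OF b(2), of x] by (simp add: s_def)
      next
        case 3
        have "(\<Sum>k=1..r. xs k * s k x) = (\<Sum>k=1..r. 0)"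
          using 3 by (intro sum.cong) (auto simp: xs_def)
        moreover have "int n dvd 2 * int b"
        proof -
          have "2 * b = n \<or> b = n" using 3 r[of b] r[of "n - b"] b by arith
          then have "n dvd 2 * b" by auto
          then show ?thesis by (metis int_dvd_int_iff of_nat_mult of_nat_numeral)
        qed
        then have "int n dvd x * (2 * int b)" by (rule dvd_mult)
        then have "R (x * int b) = R (- (x * int b))" by (intro R_cong) (simp add: algebra_simps)
        ultimately show ?thesis by simp
      qed
    qed
    have tg: "t g x = (if int n dvd x * int b then 0 else 1)" for x
      using dvd_mult_gcd_iff[of "int n" x "int b"] by (simp add: t_def g_def)
    have even_part: "(\<Sum>f\<in>D. xt f * t f x) = real n / 2 * (if int n dvd x * int b then 0 else 1)" for x
    proof (cases "g \<in> D")
      case True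
      have "(\<Sum>f\<in>D. xt f * t f x) = (\<Sum>f\<in>D. if f = g then real n / 2 * t g x else 0)"
        by (intro sum.cong) (auto simp: xt_def)
      then show ?thesis using True finD by (simp add: tg)
    next
      case False
      then have "g = n" using n dvd_imp_le[of g n] by (auto simp: D_def g_def le_less)
      then have "int n dvd x * int b"
        by (metis dvd_mult g_def gcd_dvd1 int_dvd_int_iff)
      moreover have "(\<Sum>f\<in>D. xt f * t f x) = (\<Sum>f\<in>D. 0)"
        using False by (intro sum.cong) (auto simp: xt_def)
      ultimately show ?thesis by simp
    qed
    have "A $$ (a, j) = (\<Sum>i\<in>I. case_sum xs xt i * w i a)" if "a < m" for a
      unfolding sumI entry[OF that j] w_def sum.case b_def[symmetric] odd_part even_part
      by (rule R_half)
    then show "\<exists>x. \<forall>a<m. A $$ (a, j) = (\<Sum>i\<in>I. x i * w i a)" by (intro exI[of _ "case_sum xs xt"]) simp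
  next
    fix i assume i: "i \<in> I"
    show "\<exists>y. \<forall>a<m. w i a = (\<Sum>j<m. y j * A $$ (a, j))"
    proof (cases i)
      case (Inl b)
      then have b: "0 < b" "b < n" using i r[of b] by (auto simp: I_def)
      have "w i a = (\<Sum>j<m. ((if j = b - 1 then 1 else 0) - (if j = (n - b) - 1 then 1 else 0)) * A $$ (a, j))"
        if a: "a < m" for a
        unfolding left_diff_distrib sum_subtractf Inl w_def sum.case s_def
        by (simp only: pick[OF a b] pick_refl[OF a b])
      then show ?thesis
        by (intro exI[of _ "\<lambda>j. (if j = b - 1 then 1 else 0) - (if j = (n - b) - 1 then 1 else 0)"] allI impI)
    next
      case (Inr f)
      then have f: "0 < f" "f < n" using i D0[of f] by (auto simp: I_def)
      have "w i a = (\<Sum>j<m. ((if j = f - 1 then 1 else 0) + (if j = (n - f) - 1 then 1 else 0)) * A $$ (a, j)) / real n"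
        if a: "a < m" for a
        unfolding distrib_right sum.distrib Inr w_def sum.case t_def pick[OF a f] pick_refl[OF a f] R_sum
        using n by simp
      then have "\<forall>a<m. w i a = (\<Sum>j<m. ((if j = f - 1 then 1 else 0) + (if j = (n - f) - 1 then 1 else 0)) / real n * A $$ (a, j))"
        by (simp add: sum_divide_distrib)
      then show ?thesis
        by (rule exI[of _ "\<lambda>j. ((if j = f - 1 then 1 else 0) + (if j = (n - f) - 1 then 1 else 0)) / real n"])
    qed
  next
    fix x i assume zero: "\<And>a. a < m \<Longrightarrow> (\<Sum>i\<in>I. x i * w i a) = 0" and i: "i \<in> I"
    define u where "u b = x (Inl b)" for b
    define v where "v f = x (Inr f)" for f
    define U where "U z = (\<Sum>b=1..r. u b * s b z)" for z
    define V where "V z = (\<Sum>f\<in>D. v f * t f z)" for z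
    have UV: "U (int k) + V (int k) = 0" if "1 \<le> k" "k < n" for k
    proof -
      have "k - 1 < m" using that m by auto
      from zero[OF this] show ?thesis
        using that unfolding sumI by (simp add: U_def V_def u_def v_def w_def)
    qed
    \<comment> \<open>Comparing rows \<open>k\<close> and \<open>n - k\<close> separates the odd from the even relation.\<close>
    have "s b (int (n - k)) = - s b (int k)" if "k \<le> n" for b k
      using reflect[OF that, of "int b"] by (simp add: s_def mult.commute)
    then have Urefl: "U (int (n - k)) = - U (int k)" if "k \<le> n" for k
      using that by (simp add: U_def sum_negf)
    have "int n dvd int (n - k) * int f \<longleftrightarrow> int n dvd int k * int f" if "k \<le> n" for f k
    proof -
      have "int (n - k) * int f = int n * int f - int k * int f" using that by (simp add: of_nat_diff algebra_simps)
      then show ?thesis by (metis dvd_diff_right_iff dvd_triv_left)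
    qed
    then have Vrefl: "V (int (n - k)) = V (int k)" if "k \<le> n" for k
      using that by (simp add: V_def t_def)
    have U0: "U (int k) = 0" and V0: "V (int k) = 0" if k: "1 \<le> k" "k < n" for k
      using UV[OF k] UV[of "n - k"] Urefl[of k] Vrefl[of k] k by auto
    show "x i = 0"
    proof (cases i)
      case (Inr f)
      then have f: "f dvd n" "f < n" using i by (auto simp: I_def D_def)
      have "(\<Sum>f | f dvd n \<and> f < n. if n dvd k * f then 0 else v f) = 0" if "1 \<le> k" "k < n" for k
      proof -
        have "int n dvd int k * int f \<longleftrightarrow> n dvd k * f" for f
          by (metis int_dvd_int_iff of_nat_mult)
        then have "V (int k) = (\<Sum>f\<in>D. if n dvd k * f then 0 else v f)"
          unfolding V_def by (intro sum.cong) (auto simp: t_def)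
        then show ?thesis using V0[OF that] by (simp add: D_def)
      qed
      then have "v f = 0" by (rule divisor_indicators_independent[OF n _ f])
      then show ?thesis by (simp add: Inr v_def)
    next
      case (Inl b)
      then have b: "1 \<le> b" "b \<le> r" using i by (auto simp: I_def)
      define u' where "u' k = (if k \<in> {1..r} then u k else 0)" for k
      \<comment> \<open>The odd extension of the coefficients to all residues.\<close>
      define f where "f z = complex_of_real (u' (nat (z mod int n)) - u' (nat (- z mod int n)))" for z
      have U_all: "U a = 0" for a
      proof -
        define k where "k = nat (a mod int n)"
        have k: "int k = a mod int n" "k < n" using n by (auto simp: k_def nat_less_iff)
        have "s b a = s b (int k)" for b
        proof -
          have "int n dvd (a - int k) * int b" unfolding k(1) by (simp add: dvd_minus_mod)
          then have "int n dvd a * int b - int k * int b" by (simp only: left_diff_distrib)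
          moreover from this have "int n dvd - (a * int b) - - (int k * int b)"
            using dvd_minus_iff[of "int n" "a * int b - int k * int b"] by simp
          ultimately show ?thesis unfolding s_def by (simp only: R_cong)
        qed
        then have "U a = U (int k)" by (simp add: U_def)
        also have "\<dots> = 0" using U0[of k] k(2) by (cases "k = 0") (auto simp: U_def s_def)
        finally show ?thesis .
      qed
      have ker: "(\<Sum>b<n. f (int b) * of_int (a * int b mod int n)) = 0" for a
      proof -
        define G where "G z = u' (nat (z mod int n)) * R (- (a * z))" for z
        have "G (z + int n) = G z" for z
        proof -
          have "R (- (a * (z + int n))) = R (- (a * z))" by (rule R_cong) (simp add: algebra_simps)
          then show ?thesis by (simp add: G_def)
        qed
        then have G: "(\<Sum>b<n. G (- 1 * int b)) = (\<Sum>b<n. G (int b))"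
          by (intro sum_residues_mult[OF n]) auto
        have "(\<Sum>b<n. f (int b) * of_int (a * int b mod int n))
            = complex_of_real (\<Sum>b<n. u' b * R (a * int b) - G (- 1 * int b))"
          unfolding of_real_sum
        proof (intro sum.cong refl)
          fix b assume "b \<in> {..<n}"
          then have f': "f (int b) = of_real (u' b - u' (nat (- int b mod int n)))"
            by (simp add: f_def)
          have G': "G (- 1 * int b) = u' (nat (- int b mod int n)) * R (a * int b)"
            by (simp add: G_def)
          show "f (int b) * of_int (a * int b mod int n) = complex_of_real (u' b * R (a * int b) - G (- 1 * int b))"
            unfolding f' G' by (simp only: left_diff_distrib[symmetric] of_real_mult) (simp add: R_def)
        qed
        also have "(\<Sum>b<n. u' b * R (a * int b) - G (- 1 * int b)) = (\<Sum>b<n. u' b * s b a)"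
          unfolding sum_subtractf G
          by (simp add: G_def s_def right_diff_distrib sum_subtractf)
        also have "\<dots> = (\<Sum>b=1..r. u' b * s b a)"
          by (rule sum.mono_neutral_right) (use r in \<open>auto simp: u'_def\<close>)
        also have "\<dots> = U a" unfolding U_def by (intro sum.cong) (auto simp: u'_def)
        finally show ?thesis using U_all by simp
      qed
      have "f (int b) = 0"
        by (rule odd_sawtooth_kernel_trivial[OF n _ _ ker]) (auto simp: f_def)
      moreover have "nat (int b mod int n) = b" using b r[of b] by simp
      moreover have "nat (- int b mod int n) = n - b"
      proof -
        have "- int b mod int n = int (n - b) mod int n"
          using b r[of b] by (simp add: mod_eq_dvd_iff of_nat_diff)
        then show ?thesis using b r[of b] by (simp del: of_nat_diff)
      qed
      moreover have "u' (n - b) = 0" using b r[of b] r[of "n - b"] by (auto simp: u'_def)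
      ultimately have "u b = 0" using b by (simp add: f_def u'_def)
      then show ?thesis by (simp add: Inl u_def)
    qed
  qed
  also have "card I = r + card D" unfolding I_def by (subst card_Plus) (auto simp: finD)
  finally show ?thesis by (simp add: A_def r_def D_def)
qed


theorem theorem1p1:
  fixes n :: nat
  assumes "n \<ge> 1"
  shows "real_mat_rank (C_mat n) = real_mat_rank (H_mat n) \<and>
         real_mat_rank (H_mat n) = (n - 1) div 2 + num_proper_divisors n"
proof -
  have H: "H_mat n = Matrix.mat (n - 1) (n - 1) (\<lambda>(i, j). real (((i + 1) * (j + 1)) mod n))"
    by (rule eq_matI) (auto simp: H_mat_def C_mat_def mat_delete_def)
  have D: "num_proper_divisors n = card {f. f dvd n \<and> f < n}"
    using assms unfolding num_proper_divisors_def
    by (intro arg_cong[of _ _ card]) (auto intro: Nat.gr0I)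
  show ?thesis
    using rank_multiplication_table[of n n] rank_multiplication_table[of n "n - 1"] assms
    unfolding D H by (simp add: C_mat_def)
qed

end
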